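(* Let $n$ be a positive integer and let $T$ be an ergodic measure preserving automorphism of a standard probability space $(X,\mathfrak{B},\mu)$ which is AT$(n)$. Then $T$ has zero (Kolmogorov–Sinai) entropy.
   Context: AT$(n)$: Let $T$ be a measure preserving automorphism (invertible measure preserving transformation) of a standard probability space $(X,\mathfrak{B},\mu)$, and let $L^1_+(X,\mu)$ be the set of nonnegative functions in $L^1(X,\mu)$. For an integer $n\ge 1$, the system $(X,\mathfrak{B},\mu,T)$ (or simply $T$) is AT$(n)$ if for every $\varepsilon>0$ and every finite set of functions $f_1,\ldots,f_r\in L^1_+(X,\mu)$ there exist $n$ functions $g_1,\ldots,g_n\in L^1_+(X,\mu)$, a positive integer $N$, nonnegative reals $\alpha_{i,j}^{(m)}$ ($1\le m\le n$, $1\le i\le r$, $1\le j\le N$) and integers $t_j^{(m)}$ ($1\le m\le n$, $1\le j\le N$) such that \[\Big\|f_{i}-\sum_{m=1}^{n}\sum_{j=1}^{N}\alpha_{i,j}^{(m)}\,g_{m}\circ T^{t_{j}^{(m)}}\Big\|_{1}<\varepsilon\quad\text{for } i=1,\ldots,r.\] *)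

theory Defs
  imports "HOL-Probability.Probability"
begin

section \<open>Standard probability spaces\<close>

definition standard_borel :: "'a measure \<Rightarrow> bool" where
  "standard_borel M \<longleftrightarrow>
     (\<exists>\<tau>. completely_metrizable_space \<tau> \<and> second_countable \<tau> \<and>
          topspace \<tau> = space M \<and> sets M = sigma_sets (space M) {U. openin \<tau> U})"

text \<open>
  Standardness is meant modulo null sets: on a conull set, the sigma-algebra lies between that of
  a standard Borel space and its completion under the measure. This covers both usual conventions,
  a standard Borel space with a probability measure and a (complete) Lebesgue--Rokhlin space.
  Only the measurable structure of the witness \<open>N\<close> matters, not its measure.
\<close>

definition standard_prob_space :: "'a measure \<Rightarrow> bool" where
  "standard_prob_space M \<longleftrightarrow>
     prob_space M \<and>
     (\<exists>S\<in>sets M. emeasure M S = 1 \<and>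
        (\<exists>N. standard_borel N \<and> space N = S \<and> sets N \<subseteq> sets M \<and>
             (\<forall>A\<in>sets M. A \<subseteq> S \<longrightarrow>
                (\<exists>B\<in>sets N. \<exists>C\<in>sets N. B \<subseteq> A \<and> A \<subseteq> C \<and> emeasure M (C - B) = 0))))"


section \<open>Automorphisms and ergodicity\<close>

definition mp_automorphism :: "'a measure \<Rightarrow> ('a \<Rightarrow> 'a) \<Rightarrow> bool" where
  "mp_automorphism M T \<longleftrightarrow>
     bij_betw T (space M) (space M) \<and>
     T \<in> measurable M M \<and>
     inv_into (space M) T \<in> measurable M M \<and>
     (\<forall>A\<in>sets M. emeasure M (T -` A \<inter> space M) = emeasure M A)"

definition ergodic :: "'a measure \<Rightarrow> ('a \<Rightarrow> 'a) \<Rightarrow> bool" where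
  "ergodic M T \<longleftrightarrow>
     (\<forall>A\<in>sets M. T -` A \<inter> space M = A \<longrightarrow> emeasure M A = 0 \<or> emeasure M A = 1)"

definition int_iterate :: "'a measure \<Rightarrow> ('a \<Rightarrow> 'a) \<Rightarrow> int \<Rightarrow> 'a \<Rightarrow> 'a" where
  "int_iterate M T t =
     (if 0 \<le> t then T ^^ nat t else inv_into (space M) T ^^ nat (- t))"


section \<open>The property AT(n)\<close>

definition L1_plus :: "'a measure \<Rightarrow> ('a \<Rightarrow> real) set" where
  "L1_plus M = {f. integrable M f \<and> (AE x in M. 0 \<le> f x)}"

definition AT :: "nat \<Rightarrow> 'a measure \<Rightarrow> ('a \<Rightarrow> 'a) \<Rightarrow> bool" where
  "AT n M T \<longleftrightarrow>
     (\<forall>\<epsilon>>0. \<forall>(r::nat) (f :: nat \<Rightarrow> 'a \<Rightarrow> real).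
        (\<forall>i\<in>{1..r}. f i \<in> L1_plus M) \<longrightarrow>
        (\<exists>(g :: nat \<Rightarrow> 'a \<Rightarrow> real) (N::nat) (\<alpha> :: nat \<Rightarrow> nat \<Rightarrow> nat \<Rightarrow> real) (t :: nat \<Rightarrow> nat \<Rightarrow> int).
           (\<forall>m\<in>{1..n}. g m \<in> L1_plus M) \<and> 0 < N \<and>
           (\<forall>m\<in>{1..n}. \<forall>i\<in>{1..r}. \<forall>j\<in>{1..N}. 0 \<le> \<alpha> m i j) \<and>
           (\<forall>i\<in>{1..r}.
              (LINT x|M. \<bar>f i x - (\<Sum>m=1..n. \<Sum>j=1..N. \<alpha> m i j * g m (int_iterate M T (t m j) x))\<bar>)
                < \<epsilon>)))"


section \<open>Kolmogorov--Sinai entropy\<close>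

definition finite_partition :: "'a measure \<Rightarrow> 'a set set \<Rightarrow> bool" where
  "finite_partition M P \<longleftrightarrow> finite P \<and> P \<subseteq> sets M \<and> partition_on (space M) P"

text \<open>Empty cells contribute nothing, and neither do null cells, since \<open>0 * ln 0 = 0\<close>.\<close>

definition partition_entropy :: "'a measure \<Rightarrow> 'a set set \<Rightarrow> real" where
  "partition_entropy M P = - (\<Sum>A\<in>P. measure M A * ln (measure M A))"

text \<open>The join of \<open>P\<close>, \<open>T\<^sup>-\<^sup>1 P\<close>, \<dots>, \<open>T\<^sup>-\<^sup>(\<^sup>n\<^sup>-\<^sup>1\<^sup>) P\<close>; its cells are given by the itineraries \<open>c\<close>.\<close>

definition dyn_join :: "'a measure \<Rightarrow> ('a \<Rightarrow> 'a) \<Rightarrow> 'a set set \<Rightarrow> nat \<Rightarrow> 'a set set" where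
  "dyn_join M T P n =
     {{x \<in> space M. \<forall>i<n. (T ^^ i) x \<in> c i} | c. \<forall>i<n. c i \<in> P} - {{}}"

text \<open>The limit exists by subadditivity (Fekete) whenever \<open>T\<close> preserves the measure.\<close>

definition entropy_wrt :: "'a measure \<Rightarrow> ('a \<Rightarrow> 'a) \<Rightarrow> 'a set set \<Rightarrow> real" where
  "entropy_wrt M T P = lim (\<lambda>n. partition_entropy M (dyn_join M T P n) / real n)"

definition KS_entropy :: "'a measure \<Rightarrow> ('a \<Rightarrow> 'a) \<Rightarrow> ereal" where
  "KS_entropy M T = (SUP P\<in>{P. finite_partition M P}. ereal (entropy_wrt M T P))"

end

theory Submission
  imports Defs
begin

text \<open>
  If some partition has positive entropy rate, then it is not predictable from its own future, and
  conditioning on that future yields a set \<open>A\<close> of positive measure and \<open>q < 1\<close> such that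
  \<open>A\<close> is visited at all times of a finite set \<open>S\<close> with probability at most \<open>q ^ card S\<close>,
  no matter how sparse \<open>S\<close> is. Hence visiting \<open>A\<close> at most times of \<open>S\<close> is exponentially unlikely.

  Suppose AT(\<open>n\<close>) holds and apply it to the indicators of disjoint pieces of \<open>A\<close> of small measure.
  Every term \<open>\<gamma> * g \<circ> T\<^sup>s\<close> of the approximation of \<open>A\<close> then has small mass, since the pieces are
  disjoint, and on average over the terms a \<open>g\<close>-typical point is in \<open>A\<close> at the times \<open>-s\<close>.
  Order the times of each \<open>g\<close> by decreasing weight. By a maximal inequality, for most \<open>j\<close> a typical
  point is in \<open>A\<close> at most of the first \<open>j\<close> times, so the \<open>j\<close>-th term is essentially supported on a
  set of measure exponentially small in \<open>j\<close>. The first \<open>J\<close> terms have small mass, and the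
  supports of the remaining ones have small total measure, so the terms cannot add up to a function
  that is close to the indicator of a large part of \<open>A\<close>.
\<close>

section \<open>Automorphisms and their iterates\<close>

locale automorphism = prob_space M for M :: "'a measure" +
  fixes T :: "'a \<Rightarrow> 'a"
  assumes automorphism: "mp_automorphism M T"
begin

abbreviation U :: "int \<Rightarrow> 'a \<Rightarrow> 'a" where "U \<equiv> int_iterate M T"

abbreviation T' :: "'a \<Rightarrow> 'a" where "T' \<equiv> inv_into (space M) T"

lemma T_measurable [measurable]: "T \<in> M \<rightarrow>\<^sub>M M"
  and T'_measurable [measurable]: "T' \<in> M \<rightarrow>\<^sub>M M"
  and bij_T: "bij_betw T (space M) (space M)"
  using automorphism by (auto simp: mp_automorphism_def)

lemma T_T' [simp]: "x \<in> space M \<Longrightarrow> T (T' x) = x"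
  and T'_T [simp]: "x \<in> space M \<Longrightarrow> T' (T x) = x"
  using bij_T by (auto simp: bij_betw_def intro: f_inv_into_f)

lemma T_space [simp]: "x \<in> space M \<Longrightarrow> T x \<in> space M"
  and T'_space [simp]: "x \<in> space M \<Longrightarrow> T' x \<in> space M"
  using measurable_space[OF T_measurable] measurable_space[OF T'_measurable] by auto

lemma distr_T: "distr M M T = M"
  using automorphism by (intro measure_eqI) (auto simp: emeasure_distr mp_automorphism_def)

lemma distr_T': "distr M M T' = M"
proof (rule measure_eqI)
  fix A assume "A \<in> sets (distr M M T')"
  then have A [measurable]: "A \<in> sets M" by simp
  have "emeasure (distr M M T') A = emeasure M (T' -` A \<inter> space M)"
    by (simp add: emeasure_distr)
  also have "\<dots> = emeasure (distr M M T) (T' -` A \<inter> space M)"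
    by (simp add: distr_T)
  also have "\<dots> = emeasure M (T -` (T' -` A \<inter> space M) \<inter> space M)"
    by (simp add: emeasure_distr)
  also have "T -` (T' -` A \<inter> space M) \<inter> space M = A"
    using sets.sets_into_space[OF A] by auto
  finally show "emeasure (distr M M T') A = emeasure M A" .
qed simp

lemma funpow_preserving:
  assumes "f \<in> M \<rightarrow>\<^sub>M M" "distr M M f = M"
  shows "f ^^ k \<in> M \<rightarrow>\<^sub>M M \<and> distr M M (f ^^ k) = M"
proof (induction k)
  case 0
  then show ?case by (simp add: id_def)
next
  case (Suc k)
  then have "f \<circ> f ^^ k \<in> M \<rightarrow>\<^sub>M M" using assms(1) by (auto intro: measurable_comp)
  moreover have "distr M M (f \<circ> f ^^ k) = distr (distr M M (f ^^ k)) M f"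
    using assms(1) Suc by (intro distr_distr[symmetric]) auto
  ultimately show ?case using Suc assms(2) by (simp only: funpow.simps)
qed

lemma U_measurable [measurable]: "U t \<in> M \<rightarrow>\<^sub>M M"
  and distr_U: "distr M M (U t) = M"
  using funpow_preserving[OF T_measurable distr_T] funpow_preserving[OF T'_measurable distr_T']
  by (auto simp: int_iterate_def)

lemma U_of_nat: "U (int k) = T ^^ k"
  by (simp add: int_iterate_def)

lemma U_space [simp]: "x \<in> space M \<Longrightarrow> U t x \<in> space M"
  using measurable_space[OF U_measurable] by auto

lemma T_pow_measurable [measurable]: "T ^^ k \<in> M \<rightarrow>\<^sub>M M"
  using U_measurable[of "int k"] by (simp add: U_of_nat)

lemma T_pow_space [simp]: "x \<in> space M \<Longrightarrow> (T ^^ k) x \<in> space M"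
  using U_space[of x "int k"] by (simp add: U_of_nat)

lemma U_0 [simp]: "U 0 x = x"
  by (simp add: int_iterate_def)

lemma U_succ: "x \<in> space M \<Longrightarrow> U (t + 1) x = T (U t x)"
proof (cases "0 \<le> t")
  case True
  then show ?thesis by (simp add: int_iterate_def nat_add_distrib)
next
  case False
  assume x: "x \<in> space M"
  define k where "k = nat (- t - 1)"
  have t: "t = - int (Suc k)" using False by (simp add: k_def)
  \<comment> \<open>For \<open>k = 0\<close> the time \<open>t + 1\<close> is zero and falls into
    the nonnegative branch of \<open>int_iterate\<close>.\<close>
  have "U (t + 1) x = (T' ^^ k) x"
    by (cases "k = 0") (simp_all add: t int_iterate_def)
  moreover have "U t x = T' ((T' ^^ k) x)"
    using False by (simp add: t int_iterate_def nat_add_distrib)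
  moreover have "(T' ^^ k) x \<in> space M"
    using x by (induction k) auto
  ultimately show ?thesis by simp
qed

text \<open>Integer induction from 0 in both directions. The downward step cancels \<open>T\<close>
  by applying \<open>T'\<close>, an inverse only on \<open>space M\<close>.\<close>

lemma U_add: "x \<in> space M \<Longrightarrow> U (s + t) x = U s (U t x)"
proof (induction s rule: int_induct[where k = 0])
  case base
  then show ?case by simp
next
  case (step1 i)
  have "U (i + 1 + t) x = T (U (i + t) x)"
    using U_succ[of x "i + t"] step1.prems by (simp add: algebra_simps)
  also have "\<dots> = U (i + 1) (U t x)"
    using step1 by (simp add: U_succ)
  finally show ?case .
next
  case (step2 i)
  have "T (U (i - 1 + t) x) = U (i + t) x"
    using U_succ[of x "i - 1 + t"] step2.prems by (simp add: algebra_simps)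
  also have "\<dots> = T (U (i - 1) (U t x))"
    using step2 U_succ[of "U t x" "i - 1"] by simp
  finally have "T' (T (U (i - 1 + t) x)) = T' (T (U (i - 1) (U t x)))"
    by simp
  then show ?case using step2.prems by simp
qed

lemma measure_U:
  assumes "A \<in> sets M"
  shows "measure M (U t -` A \<inter> space M) = measure M A"
  using assms distr_U[of t] by (metis U_measurable measure_distr)

lemma measure_U_Collect:
  assumes [measurable]: "Measurable.pred M Q"
  shows "measure M {x \<in> space M. Q (U t x)} = measure M {x \<in> space M. Q x}"
proof -
  have "{x \<in> space M. Q (U t x)} = U t -` {x \<in> space M. Q x} \<inter> space M" by auto
  then show ?thesis using measure_U[of "{x \<in> space M. Q x}" t] by simp
qed

lemma measure_T_pow_Collect:
  assumes "Measurable.pred M Q"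
  shows "measure M {x \<in> space M. Q ((T ^^ k) x)} = measure M {x \<in> space M. Q x}"
  using measure_U_Collect[OF assms, of "int k"] by (simp add: U_of_nat)

lemma
  fixes g :: "'a \<Rightarrow> real"
  assumes "g \<in> borel_measurable M"
  shows integral_U: "(LINT x|M. g (U t x)) = (LINT x|M. g x)"
    and integrable_U: "integrable M (\<lambda>x. g (U t x)) \<longleftrightarrow> integrable M g"
  using assms integral_distr[of "U t" M M g] integrable_distr_eq[of "U t" M M g] by (simp_all add: distr_U)

lemma AE_U:
  assumes "AE x in M. Q x"
  shows "AE x in M. Q (U t x)"
proof (rule AE_distrD[OF U_measurable])
  show "AE x in distr M M (U t). Q x"
    unfolding distr_U by (rule assms)
qed

end

section \<open>Entropy of predictable processes\<close>

text \<open>Apply \<open>ln y \<le> y - 1\<close> with \<open>y = 1 / sqrt p\<close>. The bound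
  tends to 0 with \<open>p\<close>, which suits cells of small measure.\<close>

lemma minus_p_ln_p_le_sqrt: "- (p * ln p) \<le> 2 * sqrt p" if "0 \<le> p" for p :: real
proof (cases "p = 0")
  case False
  then have p: "0 < p" using that by simp
  have "- ln p = 2 * ln (1 / sqrt p)"
    using p by (simp add: ln_div ln_sqrt)
  also have "\<dots> \<le> 2 * (1 / sqrt p - 1)"
    using p ln_le_minus_one[of "1 / sqrt p"] by simp
  finally have "p * (- ln p) \<le> p * (2 * (1 / sqrt p - 1))"
    using p by (intro mult_left_mono) auto
  also have "\<dots> = 2 * sqrt p - 2 * p"
    using p by (simp add: field_simps)
  finally show ?thesis using p by simp
qed simp

text \<open>The same inequality with \<open>y = 1 / p\<close>; this bound is small for a cell of
  measure close to 1.\<close>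

lemma minus_p_ln_p_le_1_minus: "- (p * ln p) \<le> 1 - p" if "0 \<le> p" for p :: real
proof (cases "p = 0")
  case False
  then have p: "0 < p" using that by simp
  then have "p * ln (1 / p) \<le> p * (1 / p - 1)"
    using ln_le_minus_one[of "1 / p"] by (intro mult_left_mono) auto
  then show ?thesis using p by (simp add: ln_div algebra_simps)
qed simp

section \<open>Shannon entropy of finite-valued maps\<close>

context automorphism
begin

text \<open>Base \<open>exp 1\<close> turns the logarithm of the entropy library into the
  \<open>ln\<close> of \<open>partition_entropy\<close>.\<close>

sublocale information_space M "exp 1"
  by unfold_locales simp

text \<open>Spelled out as a sum over level sets so that it compares termwise with
  \<open>partition_entropy\<close>; \<open>ent_eq_entropy\<close> links it to the library
  notion.\<close>

definition ent :: "('a \<Rightarrow> 'b) \<Rightarrow> real" where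
  "ent X = - (\<Sum>x\<in>X ` space M. prob (X -` {x} \<inter> space M) * ln (prob (X -` {x} \<inter> space M)))"

lemma ent_eq_entropy:
  assumes "simple_function M X"
  shows "ent X = entropy (exp 1) (count_space (X ` space M)) X"
  using entropy_simple_distributed[OF simple_distributedI[OF assms measure_nonneg refl]]
  by (simp add: ent_def log_def)

lemma ent_nonneg: "0 \<le> ent X"
proof -
  have "p * ln p \<le> 0" if "0 \<le> p" "p \<le> 1" for p :: real
    using that by (cases "p = 0") (auto intro: mult_nonneg_nonpos)
  then show ?thesis
    unfolding ent_def by (simp add: sum_nonpos)
qed

text \<open>On the space \<open>X\<close> factors through \<open>W\<close>, by choosing a point in
  each level set of \<open>W\<close>, so the data processing inequality applies.\<close>

lemma entropy_determined_le:
  assumes X: "simple_function M X" and W: "simple_function M W"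
    and det: "\<And>x y. x \<in> space M \<Longrightarrow> y \<in> space M \<Longrightarrow> W x = W y \<Longrightarrow> X x = X y"
  shows "ent X \<le> ent W"
proof -
  define f where "f w = X (SOME x. x \<in> space M \<and> W x = w)" for w
  have fW: "f (W x) = X x" if "x \<in> space M" for x
  proof -
    have "(SOME y. y \<in> space M \<and> W y = W x) \<in> space M \<and> W (SOME y. y \<in> space M \<and> W y = W x) = W x"
      using that by (intro someI[of "\<lambda>y. y \<in> space M \<and> W y = W x"]) simp
    then show ?thesis unfolding f_def using that by (intro det) auto
  qed
  have 1: "(f \<circ> W) ` space M = X ` space M"
    using fW by (simp add: image_comp[symmetric] cong: image_cong)
  have 2: "(f \<circ> W) -` {x} \<inter> space M = X -` {x} \<inter> space M" for x
    using fW by auto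
  have "ent X = ent (f \<circ> W)"
    by (simp only: ent_def 1 2)
  also have "\<dots> \<le> ent W"
    unfolding ent_eq_entropy[OF W] ent_eq_entropy[OF simple_function_compose[OF W]]
    by (rule entropy_data_processing[OF W])
  finally show ?thesis .
qed

text \<open>Chain rule, together with the fact that conditioning does not increase entropy.\<close>

lemma entropy_pair_le:
  assumes "simple_function M X" "simple_function M Y"
  shows "ent (\<lambda>x. (X x, Y x)) \<le> ent X + ent Y"
  unfolding ent_eq_entropy[OF assms(1)] ent_eq_entropy[OF assms(2)]
    ent_eq_entropy[OF simple_function_Pair[OF assms]] entropy_chain_rule[OF assms]
  using conditional_entropy_less_eq_entropy[OF assms(2,1)] by simp

lemma entropy_comp_T:
  assumes X: "simple_function M X"
  shows "ent (\<lambda>x. X (T x)) = ent X"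
proof -
  have "(\<lambda>x. X (T x)) ` space M = X ` (T ` space M)" by auto
  then have 1: "(\<lambda>x. X (T x)) ` space M = X ` space M"
    using bij_T by (simp add: bij_betw_def)
  have 2: "prob ((\<lambda>x. X (T x)) -` {x} \<inter> space M) = prob (X -` {x} \<inter> space M)" for x
  proof -
    have "(\<lambda>x. X (T x)) -` {x} \<inter> space M = T -` (X -` {x} \<inter> space M) \<inter> space M" by auto
    then show ?thesis
      using measure_U[of "X -` {x} \<inter> space M" 1] simple_functionD(2)[OF X, of "{x}"]
        U_of_nat[of 1] by simp
  qed
  show ?thesis
    by (simp only: ent_def 1 2)
qed

end

section \<open>Coding of orbits by the cells of a partition\<close>

locale partition_process = automorphism M T for M :: "'a measure" and T +
  fixes P :: "'a set set"
  assumes partition: "finite_partition M P"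
begin

text \<open>The partition as a finite-valued map whose symbols are the cells themselves; the
  description is meaningful only on \<open>space M\<close>.\<close>

definition label :: "'a \<Rightarrow> 'a set" where
  "label x = (THE A. A \<in> P \<and> x \<in> A)"

lemma finite_P [simp]: "finite P"
  and P_sets [measurable]: "A \<in> P \<Longrightarrow> A \<in> sets M"
  and partition_P: "partition_on (space M) P"
  using partition by (auto simp: finite_partition_def)

lemma label_eq_iff: "x \<in> space M \<Longrightarrow> A \<in> P \<Longrightarrow> label x = A \<longleftrightarrow> x \<in> A"
  and label_in: "x \<in> space M \<Longrightarrow> label x \<in> P"
proof -
  have ex: "\<exists>!A. A \<in> P \<and> x \<in> A" if "x \<in> space M" for x
    using that partition_P by (auto simp: partition_on_def disjoint_def)
  show "label x \<in> P" if "x \<in> space M"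
    using theI'[OF ex[OF that]] by (simp add: label_def)
  show "label x = A \<longleftrightarrow> x \<in> A" if "x \<in> space M" "A \<in> P"
    using theI'[OF ex[OF that(1)]] ex[OF that(1)] that(2) by (auto simp: label_def)
qed

lemma label_vimage:
  assumes "A \<in> P"
  shows "label -` {A} \<inter> space M = A"
proof (rule set_eqI)
  fix x
  show "x \<in> label -` {A} \<inter> space M \<longleftrightarrow> x \<in> A"
    using label_eq_iff[of x A] sets.sets_into_space[OF P_sets[OF assms]] assms by blast
qed

lemma simple_function_label: "simple_function M label"
  unfolding simple_function_def
proof safe
  show "finite (label ` space M)"
    by (rule finite_subset[of _ P]) (auto simp: label_in)
  fix x assume "x \<in> space M"
  then show "label -` {label x} \<inter> space M \<in> sets M"
    by (simp add: label_vimage label_in P_sets)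
qed

definition itinerary :: "nat \<Rightarrow> 'a \<Rightarrow> 'a set list" where
  "itinerary n x = map (\<lambda>i. label ((T ^^ i) x)) [0..<n]"

lemma itinerary_eq_iff:
  "itinerary n x = itinerary n y \<longleftrightarrow> (\<forall>i<n. label ((T ^^ i) x) = label ((T ^^ i) y))"
  by (auto simp: itinerary_def)

lemma simple_function_itinerary: "simple_function M (itinerary n)"
proof (induction n)
  case 0
  then show ?case by (simp add: itinerary_def[abs_def])
next
  case (Suc n)
  have "simple_function M (\<lambda>x. label ((T ^^ n) x))"
    using simple_function_comp[OF T_pow_measurable simple_function_label] by (simp add: comp_def)
  from simple_function_compose2[OF Suc this, of "\<lambda>u a. u @ [a]"]
  show ?case by (simp add: itinerary_def[abs_def])
qed

text \<open>The nonempty cells of the join are exactly the level sets of \<open>itinerary n\<close>: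
  each symbol of a cell's itinerary is the label of any of its points at that time. Removal of the
  empty cell makes the correspondence bijective.\<close>

lemma partition_entropy_dyn_join:
  "partition_entropy M (dyn_join M T P n) = ent (itinerary n)"
proof -
  let ?c = "\<lambda>w. itinerary n -` {w} \<inter> space M"
  have "bij_betw ?c (itinerary n ` space M) (dyn_join M T P n)"
    unfolding bij_betw_def
  proof
    show "inj_on ?c (itinerary n ` space M)"
      by (rule inj_onI) blast
    show "?c ` (itinerary n ` space M) = dyn_join M T P n"
    proof (intro equalityI subsetI)
      fix C assume "C \<in> ?c ` (itinerary n ` space M)"
      then obtain x where x: "x \<in> space M" and C: "C = ?c (itinerary n x)" by blast
      have lab: "label ((T ^^ i) y) = label ((T ^^ i) x) \<longleftrightarrow> (T ^^ i) y \<in> label ((T ^^ i) x)"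
        if "y \<in> space M" for i y
        using x that by (intro label_eq_iff label_in) simp_all
      have "C = {y \<in> space M. \<forall>i<n. (T ^^ i) y \<in> label ((T ^^ i) x)}"
        unfolding C vimage_def Int_def mem_Collect_eq singleton_iff itinerary_eq_iff
        using lab by (intro Collect_cong) (metis (no_types))
      moreover have "x \<in> C" using x by (simp add: C)
      moreover have "\<forall>i<n. label ((T ^^ i) x) \<in> P" using x label_in by simp
      ultimately show "C \<in> dyn_join M T P n"
        unfolding dyn_join_def
        by (intro DiffI CollectI exI[of _ "\<lambda>i. label ((T ^^ i) x)"] conjI) blast+
    next
      fix C assume "C \<in> dyn_join M T P n"
      then obtain c where cP: "\<And>i. i < n \<Longrightarrow> c i \<in> P"
        and C: "C = {x \<in> space M. \<forall>i<n. (T ^^ i) x \<in> c i}" and "C \<noteq> {}"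
        unfolding dyn_join_def by blast
      then obtain x where x: "x \<in> space M" "\<And>i. i < n \<Longrightarrow> (T ^^ i) x \<in> c i" by blast
      have lab: "label ((T ^^ i) y) = c i \<longleftrightarrow> (T ^^ i) y \<in> c i" if "i < n" "y \<in> space M" for i y
        using cP[OF that(1)] that(2) by (intro label_eq_iff) simp_all
      have labx: "label ((T ^^ i) x) = c i" if "i < n" for i
        using lab[OF that x(1)] x(2)[OF that] by blast
      have "C = ?c (itinerary n x)"
        unfolding C vimage_def Int_def mem_Collect_eq singleton_iff itinerary_eq_iff
        using lab labx by (intro Collect_cong) (metis (no_types))
      then show "C \<in> ?c ` (itinerary n ` space M)" using x(1) by blast
    qed
  qed
  from sum.reindex_bij_betw[OF this, of "\<lambda>A. prob A * ln (prob A)"]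
  show ?thesis
    by (simp add: partition_entropy_def ent_def)
qed

text \<open>Side information that corrects a prediction failing only on \<open>E\<close>: it reveals
  the label there and nothing else elsewhere.\<close>

definition error_label :: "'a set \<Rightarrow> 'a \<Rightarrow> 'a set option" where
  "error_label E x = (if x \<in> E then Some (label x) else None)"

lemma simple_function_error_label:
  assumes [measurable]: "E \<in> sets M"
  shows "simple_function M (error_label E)"
proof -
  have "simple_function M (\<lambda>x. Some (label x))"
    using simple_function_compose1[OF simple_function_label] by blast
  then show ?thesis
    unfolding error_label_def[abs_def] by (intro simple_function_If_set) auto
qed

text \<open>The value \<open>None\<close> has probability \<open>1 - prob E\<close>, and each of the
  at most \<open>card P\<close> other values has probability at most \<open>prob E\<close>. The two
  elementary bounds on \<open>- (p * ln p)\<close> cover these cases.\<close>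

lemma entropy_error_label_le:
  assumes E: "E \<in> sets M"
  shows "ent (error_label E) \<le> prob E + 2 * real (card P) * sqrt (prob E)"
proof -
  let ?Z = "error_label E"
  let ?p = "\<lambda>z. prob (?Z -` {z} \<inter> space M)"
  define b where "b z = (case z of None \<Rightarrow> prob E | Some _ \<Rightarrow> 2 * sqrt (prob E))" for z :: "'a set option"
  have "ent (?Z) = (\<Sum>z\<in>?Z ` space M. - (?p z * ln (?p z)))"
    by (simp add: ent_def sum_negf)
  also have "\<dots> \<le> (\<Sum>z\<in>?Z ` space M. b z)"
  proof (rule sum_mono)
    fix z assume "z \<in> ?Z ` space M"
    show "- (?p z * ln (?p z)) \<le> b z"
    proof (cases z)
      case None
      then have "?Z -` {z} \<inter> space M = space M - E"
        by (auto simp: error_label_def)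
      then have "?p z = 1 - prob E"
        using prob_compl[OF E] by simp
      then show ?thesis
        using minus_p_ln_p_le_1_minus[of "?p z"] None by (simp add: b_def)
    next
      case (Some A)
      then have "?p z \<le> prob E"
        using E by (intro finite_measure_mono) (auto simp: error_label_def split: if_splits)
      then show ?thesis
        using minus_p_ln_p_le_sqrt[of "?p z"] Some real_sqrt_le_mono[of "?p z" "prob E"]
        by (simp add: b_def del: real_sqrt_le_iff)
    qed
  qed
  also have "\<dots> \<le> (\<Sum>z\<in>insert None (Some ` P). b z)"
    by (rule sum_mono2) (auto simp: error_label_def label_in b_def split: option.split)
  also have "\<dots> = prob E + (\<Sum>z\<in>Some ` P. b z)"
    by (subst sum.insert) (auto simp: b_def)
  also have "(\<Sum>z\<in>Some ` P. b z) = (\<Sum>A\<in>P. 2 * sqrt (prob E))"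
    by (subst sum.reindex) (auto simp: b_def)
  finally show ?thesis by simp
qed

text \<open>The labels at times \<open>1\<close> to \<open>n\<close> determine the label at time 0
  outside \<open>E\<close>, and the error label supplies it on \<open>E\<close>. Subadditivity and
  stationarity then bound the cost of one more symbol.\<close>

lemma entropy_itinerary_Suc_le:
  assumes E: "E \<in> sets M"
    and det: "\<And>x y. x \<in> space M - E \<Longrightarrow> y \<in> space M - E \<Longrightarrow>
      (\<And>i. i \<in> {1..K} \<Longrightarrow> label ((T ^^ i) x) = label ((T ^^ i) y)) \<Longrightarrow> label x = label y"
    and "K \<le> n"
  shows "ent (itinerary (Suc n)) \<le> ent (itinerary n) + ent (error_label E)"
proof -
  have sfT: "simple_function M (\<lambda>x. itinerary n (T x))"
    using simple_function_comp[OF T_measurable simple_function_itinerary] by (simp add: comp_def)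
  note sfZ = simple_function_error_label[OF E]
  have "ent (itinerary (Suc n)) \<le> ent (\<lambda>x. (itinerary n (T x), error_label E x))"
  proof (rule entropy_determined_le[OF simple_function_itinerary simple_function_Pair[OF sfT sfZ]])
    fix x y assume xy: "x \<in> space M" "y \<in> space M"
      and "(itinerary n (T x), error_label E x) = (itinerary n (T y), error_label E y)"
    then have it: "\<And>i. i < n \<Longrightarrow> label ((T ^^ Suc i) x) = label ((T ^^ Suc i) y)"
      and Z: "error_label E x = error_label E y"
      by (auto simp: itinerary_eq_iff funpow_swap1)
    have it': "label ((T ^^ i) x) = label ((T ^^ i) y)" if "i \<in> {1..n}" for i
      using it[of "i - 1"] that by (cases i) auto
    have "label x = label y"
    proof (cases "x \<in> E")
      case True
      then show ?thesis using Z by (cases "y \<in> E") (simp_all add: error_label_def)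
    next
      case False
      then have "y \<notin> E" using Z by (cases "y \<in> E") (simp_all add: error_label_def)
      show ?thesis
      proof (rule det)
        show "x \<in> space M - E" "y \<in> space M - E"
          using xy False \<open>y \<notin> E\<close> by auto
      next
        fix i assume "i \<in> {1..K}"
        then show "label ((T ^^ i) x) = label ((T ^^ i) y)"
          using it'[of i] \<open>K \<le> n\<close> by auto
      qed
    qed
    then show "itinerary (Suc n) x = itinerary (Suc n) y"
      unfolding itinerary_eq_iff
    proof (intro allI impI)
      fix i assume "i < Suc n"
      then show "label ((T ^^ i) x) = label ((T ^^ i) y)"
        using it'[of i] \<open>label x = label y\<close> by (cases "i = 0") auto
    qed
  qed
  also have "\<dots> \<le> ent (\<lambda>x. itinerary n (T x)) + ent (error_label E)"
    by (rule entropy_pair_le[OF sfT sfZ])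
  also have "ent (\<lambda>x. itinerary n (T x)) = ent (itinerary n)"
    by (rule entropy_comp_T[OF simple_function_itinerary])
  finally show ?thesis .
qed

text \<open>Once the itinerary has length at least \<open>K\<close>, each further symbol adds at
  most \<open>ent (error_label E)\<close>, which is arbitrarily small; the entropy of the first
  \<open>K\<close> symbols vanishes in the average.\<close>

lemma entropy_rate_zero_if_predictable:
  assumes "\<And>e. 0 < e \<Longrightarrow> \<exists>E\<in>sets M. \<exists>K. prob E < e \<and>
      (\<forall>x\<in>space M - E. \<forall>y\<in>space M - E.
        (\<forall>i\<in>{1..K}. label ((T ^^ i) x) = label ((T ^^ i) y)) \<longrightarrow> label x = label y)"
  shows "(\<lambda>n. ent (itinerary n) / real n) \<longlonglongrightarrow> 0"
proof (rule LIMSEQ_I)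
  fix r :: real assume "0 < r"
  define d where "d = r / 2"
  have d: "0 < d" using \<open>0 < r\<close> by (simp add: d_def)
  define c where "c = real (card P) + 1"
  have c: "0 < c" by (simp add: c_def)
  \<comment> \<open>The two entries make the two summands of \<open>entropy_error_label_le\<close>
    at most \<open>d / 2\<close> each.\<close>
  define e where "e = min (d / 2) ((d / (4 * c))\<^sup>2)"
  have "0 < e" using d c by (simp add: e_def)
  from assms[OF this] obtain E K where E: "E \<in> sets M" "prob E < e"
    and det: "\<forall>x\<in>space M - E. \<forall>y\<in>space M - E.
      (\<forall>i\<in>{1..K}. label ((T ^^ i) x) = label ((T ^^ i) y)) \<longrightarrow> label x = label y"
    by (elim bexE exE conjE) (rule that)
  have e: "e \<le> d / 2" "e \<le> (d / (4 * c))\<^sup>2" by (auto simp: e_def)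
  then have "sqrt (prob E) \<le> sqrt ((d / (4 * c))\<^sup>2)"
    using E(2) by (intro real_sqrt_le_mono) linarith
  also have "\<dots> = d / (4 * c)"
    using d c by simp
  finally have "2 * c * sqrt (prob E) \<le> 2 * c * (d / (4 * c))"
    using c by (intro mult_left_mono) auto
  also have "\<dots> = d / 2" using c by simp
  finally have "2 * c * sqrt (prob E) \<le> d / 2" .
  moreover have "2 * real (card P) * sqrt (prob E) \<le> 2 * c * sqrt (prob E)"
    by (intro mult_right_mono) (auto simp: c_def)
  ultimately have Z: "ent (error_label E) \<le> d"
    using entropy_error_label_le[OF E(1)] E(2) e(1) by linarith
  have *: "ent (itinerary (K + j)) \<le> ent (itinerary K) + real j * d" for j
  proof (induction j)
    case (Suc j)
    have "ent (itinerary (Suc (K + j))) \<le> ent (itinerary (K + j)) + ent (error_label E)"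
    proof (rule entropy_itinerary_Suc_le[OF E(1)])
      fix x y assume xy: "x \<in> space M - E" "y \<in> space M - E"
        and "\<And>i. i \<in> {1..K} \<Longrightarrow> label ((T ^^ i) x) = label ((T ^^ i) y)"
      then show "label x = label y"
        using det[rule_format, OF xy] by simp
    qed simp
    with Suc Z show ?case by (simp add: algebra_simps)
  qed simp
  define C where "C = ent (itinerary K)"
  \<comment> \<open>Beyond \<open>n0\<close> the initial entropy \<open>C\<close> is below
    \<open>real n * d\<close>, so the total stays below \<open>2 * d = r\<close> per symbol.\<close>
  obtain n0 where n0: "C / d < real n0" using reals_Archimedean2 by blast
  show "\<exists>no. \<forall>n\<ge>no. norm (ent (itinerary n) / real n - 0) < r"
  proof (intro exI allI impI)
    fix n assume n: "max (max n0 K) 1 \<le> n"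
    then have "ent (itinerary n) \<le> C + real (n - K) * d"
      using *[of "n - K"] by (simp add: C_def)
    moreover have "real (n - K) * d \<le> real n * d"
      using d by (intro mult_right_mono) auto
    moreover have "C < real n * d"
    proof -
      have "C / d < real n" using n0 n by linarith
      then show ?thesis using d by (simp add: pos_divide_less_eq)
    qed
    ultimately have "ent (itinerary n) < r * real n"
      by (simp add: d_def mult.commute[of r])
    moreover have "0 \<le> ent (itinerary n)" by (rule ent_nonneg)
    ultimately show "norm (ent (itinerary n) / real n - 0) < r"
      using n by (simp add: pos_divide_less_eq)
  qed
qed

end

section \<open>Unpredictable sets from positive entropy\<close>

context partition_process
begin

definition future :: "nat \<Rightarrow> 'a measure" where
  "future k = sigma (space M) {(T ^^ i) -` A \<inter> space M | i A. k \<le> i \<and> A \<in> P}"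

lemma future_generators: "{(T ^^ i) -` A \<inter> space M | i A. k \<le> i \<and> A \<in> P} \<subseteq> sets M"
  using measurable_sets[OF T_pow_measurable P_sets] by blast

lemma sets_future: "sets (future k) = sigma_sets (space M) {(T ^^ i) -` A \<inter> space M | i A. k \<le> i \<and> A \<in> P}"
  unfolding future_def by (rule sets_measure_of) blast

lemma space_future [simp]: "space (future k) = space M"
  unfolding future_def by (rule space_measure_of) blast

lemma subalgebra_future: "subalgebra M (future k)"
  using sets.sigma_sets_subset[OF future_generators]
  by (simp add: subalgebra_def sets_future)

lemma future_mono: "j \<le> k \<Longrightarrow> sets (future k) \<subseteq> sets (future j)"
  unfolding sets_future by (rule sigma_sets_mono') (auto intro: le_trans)

text \<open>The preimage under \<open>T ^^ k\<close> of a generator at time \<open>i\<close> is the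
  generator at time \<open>i + k\<close>.\<close>

lemma future_shift:
  assumes "C \<in> sets (future 0)"
  shows "(T ^^ k) -` C \<inter> space M \<in> sets (future k)"
proof -
  have "T ^^ k \<in> future k \<rightarrow>\<^sub>M future 0"
    unfolding future_def[of 0]
  proof (rule measurable_measure_of)
    show "T ^^ k \<in> space (future k) \<rightarrow> space M" by simp
    fix y assume "y \<in> {(T ^^ i) -` A \<inter> space M | i A. 0 \<le> i \<and> A \<in> P}"
    then obtain i A where A: "A \<in> P" and y: "y = (T ^^ i) -` A \<inter> space M" by blast
    have eq: "(T ^^ k) -` y \<inter> space (future k) = (T ^^ (i + k)) -` A \<inter> space M"
      by (auto simp: y funpow_add)
    show "(T ^^ k) -` y \<inter> space (future k) \<in> sets (future k)"
      unfolding sets_future eq using A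
      by (intro sigma_sets.Basic CollectI exI[of _ "i + k"] exI[of _ A]) simp
  qed blast
  from measurable_sets[OF this assms] show ?thesis by simp
qed

text \<open>A cylinder condition on times \<open>1\<close> to \<open>K\<close>. Time 0 is excluded,
  since the present label is what the future should predict.\<close>

definition determined :: "nat \<Rightarrow> 'a set \<Rightarrow> bool" where
  "determined K G \<longleftrightarrow> (\<forall>x\<in>space M. \<forall>y\<in>space M.
     (\<forall>i\<in>{1..K}. label ((T ^^ i) x) = label ((T ^^ i) y)) \<longrightarrow> (x \<in> G \<longleftrightarrow> y \<in> G))"

lemma determined_mono: "determined K G \<Longrightarrow> K \<le> L \<Longrightarrow> determined L G"
  unfolding determined_def by (meson atLeastAtMost_iff le_trans)

lemma determined_Un:
  assumes "determined K G" "determined L H"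
  shows "determined (max K L) (G \<union> H)"
proof -
  have G: "determined (max K L) G" and H: "determined (max K L) H"
    using assms by (auto intro: determined_mono)
  show ?thesis
    unfolding determined_def
  proof (intro ballI impI)
    fix x y
    assume xy: "x \<in> space M" "y \<in> space M"
      and eq: "\<forall>i\<in>{1..max K L}. label ((T ^^ i) x) = label ((T ^^ i) y)"
    show "x \<in> G \<union> H \<longleftrightarrow> y \<in> G \<union> H"
      using G[unfolded determined_def, rule_format, OF xy] H[unfolded determined_def, rule_format, OF xy] eq
      by (simp only: Un_iff)
  qed
qed

definition approximable :: "'a set \<Rightarrow> bool" where
  "approximable D \<longleftrightarrow> D \<in> sets M \<and>
     (\<forall>e>0. \<exists>G\<in>sets M. \<exists>K. prob (sym_diff D G) < e \<and> determined K G)"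

lemma prob_sym_diff_triangle:
  assumes [measurable]: "A \<in> sets M" "B \<in> sets M" "C \<in> sets M"
  shows "prob (sym_diff A C) \<le> prob (sym_diff A B) + prob (sym_diff B C)"
proof -
  have "prob (sym_diff A C) \<le> prob (sym_diff A B \<union> sym_diff B C)"
    by (rule finite_measure_mono) auto
  also have "\<dots> \<le> prob (sym_diff A B) + prob (sym_diff B C)"
    by (rule measure_Un_le) auto
  finally show ?thesis .
qed

lemma approximable_Un:
  assumes "approximable A" "approximable B"
  shows "approximable (A \<union> B)"
  unfolding approximable_def
proof (intro conjI allI impI)
  have [measurable]: "A \<in> sets M" "B \<in> sets M"
    using assms by (auto simp: approximable_def)
  show "A \<union> B \<in> sets M" by simp
  fix e :: real assume "0 < e"
  then have "0 < e / 2" by simp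
  then obtain G K H L where [measurable]: "G \<in> sets M" "H \<in> sets M"
    and e: "prob (sym_diff A G) < e / 2" "prob (sym_diff B H) < e / 2"
    and "determined K G" "determined L H"
    using assms unfolding approximable_def by meson
  have "prob (sym_diff (A \<union> B) (G \<union> H)) \<le> prob (sym_diff A G \<union> sym_diff B H)"
    by (rule finite_measure_mono) auto
  also have "\<dots> \<le> prob (sym_diff A G) + prob (sym_diff B H)"
    by (rule measure_Un_le) auto
  also have "\<dots> < e" using e by simp
  finally have "prob (sym_diff (A \<union> B) (G \<union> H)) < e" .
  moreover have "determined (max K L) (G \<union> H)"
    using \<open>determined K G\<close> \<open>determined L H\<close> by (rule determined_Un)
  ultimately show "\<exists>G\<in>sets M. \<exists>K. prob (sym_diff (A \<union> B) G) < e \<and> determined K G"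
    by (intro bexI[of _ "G \<union> H"] exI[of _ "max K L"]) auto
qed

lemma approximable_empty: "approximable {}"
  unfolding approximable_def by (auto intro!: bexI[of _ "{}"] simp: determined_def)

text \<open>Continuity from below replaces the union by a finite one at cost \<open>e / 2\<close>;
  the finite union is approximable within the other \<open>e / 2\<close>.\<close>

lemma approximable_UN_nat:
  fixes D :: "nat \<Rightarrow> 'a set"
  assumes "\<And>i. approximable (D i)"
  shows "approximable (\<Union>i. D i)"
  unfolding approximable_def
proof (intro conjI allI impI)
  have [measurable]: "D i \<in> sets M" for i using assms by (auto simp: approximable_def)
  show "(\<Union>i. D i) \<in> sets M" by simp
  have fin: "approximable (\<Union>i<n. D i)" for n
    by (induction n) (auto simp: approximable_empty lessThan_Suc intro: approximable_Un assms)
  fix e :: real assume "0 < e"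
  have "(\<lambda>n. prob (\<Union>i<n. D i)) \<longlonglongrightarrow> prob (\<Union>n. \<Union>i<n. D i)"
  proof (rule finite_Lim_measure_incseq)
    show "incseq (\<lambda>n. \<Union>i<n. D i)"
      unfolding incseq_def by (intro allI impI UN_mono) auto
  qed auto
  also have "(\<Union>n. \<Union>i<n. D i) = (\<Union>i. D i)" by blast
  finally have "eventually (\<lambda>n. prob (\<Union>i<n. D i) > prob (\<Union>i. D i) - e / 2) sequentially"
    using \<open>0 < e\<close> by (intro order_tendstoD) auto
  then obtain n where n: "prob (\<Union>i<n. D i) > prob (\<Union>i. D i) - e / 2"
    by (auto simp: eventually_sequentially)
  have "sym_diff (\<Union>i. D i) (\<Union>i<n. D i) = (\<Union>i. D i) - (\<Union>i<n. D i)" by auto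
  then have 1: "prob (sym_diff (\<Union>i. D i) (\<Union>i<n. D i)) < e / 2"
    using n by (simp only:) (subst finite_measure_Diff, auto)
  obtain G K where [measurable]: "G \<in> sets M"
    and 2: "prob (sym_diff (\<Union>i<n. D i) G) < e / 2" "determined K G"
    using fin[of n] half_gt_zero[OF \<open>0 < e\<close>] unfolding approximable_def by meson
  have "prob (sym_diff (\<Union>i. D i) G) < e"
    using prob_sym_diff_triangle[of "\<Union>i. D i" "\<Union>i<n. D i" G] 1 2(1) by simp
  then show "\<exists>G\<in>sets M. \<exists>K. prob (sym_diff (\<Union>i. D i) G) < e \<and> determined K G"
    using 2(2) by (intro bexI[of _ G] exI[of _ K]) auto
qed

text \<open>The approximable sets form a sigma-algebra, and the generators of
  \<open>future 1\<close> are themselves determined by finitely many labels.\<close>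

lemma approximable_future:
  assumes "D \<in> sets (future 1)"
  shows "approximable D"
  using assms unfolding sets_future
proof (induction rule: sigma_sets.induct)
  case (Basic D)
  then obtain i A where i: "1 \<le> i" and A: "A \<in> P" and D: "D = (T ^^ i) -` A \<inter> space M" by blast
  have [measurable]: "D \<in> sets M" using Basic future_generators by blast
  have "determined i D"
    unfolding determined_def
  proof (intro ballI impI)
    fix x y assume xy: "x \<in> space M" "y \<in> space M"
      and "\<forall>j\<in>{1..i}. label ((T ^^ j) x) = label ((T ^^ j) y)"
    then have "label ((T ^^ i) x) = label ((T ^^ i) y)" using i by simp
    then have "(T ^^ i) x \<in> A \<longleftrightarrow> (T ^^ i) y \<in> A"
      using label_eq_iff[OF T_pow_space A] xy by metis
    then show "x \<in> D \<longleftrightarrow> y \<in> D" using xy by (simp add: D)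
  qed
  then show ?case
    unfolding approximable_def by (auto intro!: bexI[of _ D] exI[of _ i])
next
  case Empty
  show ?case by (rule approximable_empty)
next
  case (Compl D)
  show ?case
    unfolding approximable_def
  proof (intro conjI allI impI)
    have D [measurable]: "D \<in> sets M" using Compl.IH by (simp add: approximable_def)
    show "space M - D \<in> sets M" by simp
    fix e :: real assume "0 < e"
    then obtain G K where G [measurable]: "G \<in> sets M"
      and *: "prob (sym_diff D G) < e" "determined K G"
      using Compl.IH unfolding approximable_def by meson
    have "sym_diff (space M - D) (space M - G) = sym_diff D G"
      using sets.sets_into_space[OF D] sets.sets_into_space[OF G] by auto
    moreover have "determined K (space M - G)"
      using *(2) unfolding determined_def by blast
    ultimately show "\<exists>G\<in>sets M. \<exists>K. prob (sym_diff (space M - D) G) < e \<and> determined K G"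
      using *(1) by (intro bexI[of _ "space M - G"] exI[of _ K]) auto
  qed
next
  case (Union D)
  then show ?case by (intro approximable_UN_nat)
qed

text \<open>A cell whose conditional probability given the future is 0 or 1 agrees, up to a null
  set, with a set of the future, and hence up to a small error with a cylinder set. The finitely
  many errors are collected in \<open>E\<close>.\<close>

lemma predictable_if_cond_exp_0_1:
  assumes AE01: "\<And>A. A \<in> P \<Longrightarrow>
      AE x in M. real_cond_exp M (future 1) (indicator A) x \<in> {0, 1}"
    and "0 < e"
  shows "\<exists>E\<in>sets M. \<exists>K. prob E < e \<and>
      (\<forall>x\<in>space M - E. \<forall>y\<in>space M - E.
        (\<forall>i\<in>{1..K}. label ((T ^^ i) x) = label ((T ^^ i) y)) \<longrightarrow> label x = label y)"
proof -
  interpret F: sigma_finite_subalgebra M "future 1"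
    by (intro finite_measure_subalgebra_is_sigma_finite finite_measure_subalgebra.intro
        finite_measure_subalgebra_axioms.intro subalgebra_future) unfold_locales
  have "\<exists>G K. G \<in> sets M \<and> prob (sym_diff A G) < e / (real (card P) + 1) \<and> determined K G"
    if A: "A \<in> P" for A
  proof -
    let ?f = "real_cond_exp M (future 1) (indicator A)"
    have [measurable]: "A \<in> sets M" using A by simp
    \<comment> \<open>The set where the future makes \<open>A\<close> certain; it will differ from
      \<open>A\<close> by a null set.\<close>
    define D where "D = {x \<in> space M. ?f x = 1}"
    have DF: "D \<in> sets (future 1)"
    proof -
      have "{x \<in> space (future 1). ?f x = 1} \<in> sets (future 1)" by measurable
      then show ?thesis by (simp add: D_def)
    qed
    then have D'F: "space M - D \<in> sets (future 1)"
      using sets.compl_sets[OF DF] by simp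
    have [measurable]: "D \<in> sets M" using DF subalgebra_future by (auto simp: subalgebra_def)
    have int: "integrable M (indicator A :: 'a \<Rightarrow> real)" by (simp add: emeasure_eq_measure)
    have set_ind: "(LINT x:C|M. indicat_real A x) = prob (A \<inter> C)" if "C \<in> sets M" for C
    proof -
      have "(LINT x:C|M. indicat_real A x) = (LINT x|M. indicat_real (A \<inter> C) x)"
        unfolding set_lebesgue_integral_def
        by (intro Bochner_Integration.integral_cong) (auto simp: indicator_def)
      then show ?thesis using that by simp
    qed
    have "prob (A \<inter> D) = (LINT x:D|M. ?f x)"
      using F.real_cond_exp_intA[OF int DF] set_ind[of D] by simp
    also have "\<dots> = (LINT x:D|M. 1)"
      unfolding set_lebesgue_integral_def
      by (intro Bochner_Integration.integral_cong) (auto simp: indicator_def D_def)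
    also have "\<dots> = prob D"
      by (simp add: set_lebesgue_integral_def)
    finally have AD: "prob (A \<inter> D) = prob D" .
    have "prob (A \<inter> (space M - D)) = (LINT x:space M - D|M. ?f x)"
      using F.real_cond_exp_intA[OF int D'F] set_ind[of "space M - D"] by simp
    also have "\<dots> = (LINT x|M. 0)"
      unfolding set_lebesgue_integral_def
    proof (rule integral_cong_AE)
      show "AE x in M. indicat_real (space M - D) x *\<^sub>R ?f x = 0"
        using AE01[OF A] by eventually_elim (auto simp: indicator_def D_def)
    qed auto
    finally have "prob (A \<inter> (space M - D)) = 0" by simp
    moreover have "prob (D - A) = 0"
      using AD finite_measure_Diff'[of D A] by (simp add: Int_commute)
    moreover have "A \<inter> (space M - D) = A - D"
      using sets.sets_into_space[of A M] by auto
    ultimately have AD0: "prob (sym_diff A D) = 0"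
      using measure_Un_le[of "A - D" M "D - A"] measure_nonneg[of M "sym_diff A D"] by simp
    have "0 < e / (real (card P) + 1)" using \<open>0 < e\<close> by simp
    then obtain G K where [measurable]: "G \<in> sets M"
      and G: "prob (sym_diff D G) < e / (real (card P) + 1)" "determined K G"
      using approximable_future[OF DF] unfolding approximable_def by meson
    have "prob (sym_diff A G) < e / (real (card P) + 1)"
      using prob_sym_diff_triangle[of A D G] AD0 G(1) by simp
    then show ?thesis using G(2) by (intro exI[of _ G] exI[of _ K]) auto
  qed
  then obtain G K where G: "\<And>A. A \<in> P \<Longrightarrow> G A \<in> sets M"
    and Ge: "\<And>A. A \<in> P \<Longrightarrow> prob (sym_diff A (G A)) < e / (real (card P) + 1)"
    and Gdet: "\<And>A. A \<in> P \<Longrightarrow> determined (K A) (G A)"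
    by metis
  \<comment> \<open>Outside \<open>E\<close>, membership in each cell \<open>A\<close> can be read
    off from \<open>G A\<close>, and hence from the labels up to time \<open>sum K P\<close>, which
    dominates every \<open>K A\<close>.\<close>
  define E where "E = (\<Union>A\<in>P. sym_diff A (G A))"
  have meas: "sym_diff A (G A) \<in> sets M" if "A \<in> P" for A
    using G[OF that] P_sets[OF that] by auto
  have "prob E \<le> (\<Sum>A\<in>P. prob (sym_diff A (G A)))"
    unfolding E_def using meas by (intro finite_measure_subadditive_finite) auto
  also have "\<dots> \<le> (\<Sum>A\<in>P. e / (real (card P) + 1))"
    using Ge by (intro sum_mono) (simp add: less_imp_le)
  also have "\<dots> < e" using \<open>0 < e\<close> by (simp add: field_simps)
  finally have "prob E < e" .
  moreover have "E \<in> sets M" unfolding E_def using meas by auto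
  moreover have "label x = label y"
    if x: "x \<in> space M - E" and y: "y \<in> space M - E"
      and eq: "\<forall>i\<in>{1..sum K P}. label ((T ^^ i) x) = label ((T ^^ i) y)" for x y
  proof -
    define A where "A = label x"
    have A: "A \<in> P" "x \<in> A"
      using x label_in[of x] label_eq_iff[of x A] by (auto simp: A_def)
    have "K A \<le> sum K P" using A by (simp add: member_le_sum)
    then have "determined (sum K P) (G A)" using Gdet[OF A(1)] determined_mono by blast
    moreover have "x \<in> G A" using A x by (auto simp: E_def)
    ultimately have "y \<in> G A" using x y eq unfolding determined_def by blast
    then have "y \<in> A" using A y by (auto simp: E_def)
    then show ?thesis using label_eq_iff[of y A] y A by (simp add: A_def)
  qed
  ultimately show ?thesis by blast
qed

text \<open>Some cell has, with positive probability, a conditional probability given the future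
  strictly between 0 and 1. Restricting the cell to where this value is positive and at most
  \<open>q < 1\<close> gives \<open>A\<close>. Peeling off the earliest time of \<open>S\<close>
  then gains a factor \<open>q\<close> at each visit.\<close>

lemma exists_unpredictable_set:
  assumes "\<not> (\<lambda>n. ent (itinerary n) / real n) \<longlonglongrightarrow> 0"
  shows "\<exists>A q. A \<in> sets M \<and> 0 < prob A \<and> 0 \<le> q \<and> q < 1 \<and>
    (\<forall>S. finite S \<longrightarrow> prob {x \<in> space M. \<forall>s\<in>S. (T ^^ s) x \<in> A} \<le> q ^ card S)"
proof -
  interpret F: sigma_finite_subalgebra M "future 1"
    by (intro finite_measure_subalgebra_is_sigma_finite finite_measure_subalgebra.intro
        finite_measure_subalgebra_axioms.intro subalgebra_future) unfold_locales
  obtain A0 where A0: "A0 \<in> P"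
    and not01: "\<not> (AE x in M. real_cond_exp M (future 1) (indicator A0) x \<in> {0, 1})"
    using assms entropy_rate_zero_if_predictable predictable_if_cond_exp_0_1 by blast
  have [measurable]: "A0 \<in> sets M" using A0 by simp
  let ?f = "real_cond_exp M (future 1) (indicator A0)"
  have int: "integrable M (indicator A0 :: 'a \<Rightarrow> real)" by (simp add: emeasure_eq_measure)
  have intf: "integrable M ?f" using F.real_cond_exp_int(1)[OF int] .
  have f0: "AE x in M. 0 \<le> ?f x"
    by (rule F.real_cond_exp_pos) auto
  have f1: "AE x in M. ?f x \<le> 1"
    by (rule F.real_cond_exp_le_c[OF int]) auto
  \<comment> \<open>Up to null sets these countably many sets exhaust the points where
    \<open>?f\<close> is neither 0 nor 1, so one of them has positive measure.\<close>
  define B where "B k = {x \<in> space M. 0 < ?f x \<and> ?f x \<le> 1 - 1 / (real k + 1)}" for k :: nat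
  have BF: "B k \<in> sets (future 1)" for k
  proof -
    have "{x \<in> space (future 1). 0 < ?f x \<and> ?f x \<le> 1 - 1 / (real k + 1)} \<in> sets (future 1)" by measurable
    then show ?thesis by (simp add: B_def)
  qed
  have BM [measurable]: "B k \<in> sets M" for k
    using BF subalgebra_future by (auto simp: subalgebra_def)
  have "\<exists>k. prob (B k) \<noteq> 0"
  proof (rule ccontr)
    assume "\<nexists>k. prob (B k) \<noteq> 0"
    then have "AE x in M. x \<notin> B k" for k
      by (intro AE_not_in) (auto simp: null_sets_def emeasure_eq_measure)
    then have "AE x in M. \<forall>k. x \<notin> B k" by (simp add: AE_all_countable)
    then have "AE x in M. ?f x \<in> {0, 1}"
      using f0 f1 AE_space
    proof eventually_elim
      fix x assume x: "\<forall>k. x \<notin> B k" "0 \<le> ?f x" "?f x \<le> 1" "x \<in> space M"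
      show "?f x \<in> {0, 1}"
      proof (rule ccontr)
        assume "?f x \<notin> {0, 1}"
        then have "0 < ?f x" "0 < 1 - ?f x" using x by auto
        then obtain k :: nat where "inverse (real (Suc k)) < 1 - ?f x"
          using reals_Archimedean by blast
        then have "?f x \<le> 1 - 1 / (real k + 1)"
          by (simp add: inverse_eq_divide add.commute)
        then have "x \<in> B k" using x \<open>0 < ?f x\<close>
          by (simp add: B_def)
        then show False using x by blast
      qed
    qed
    then show False using not01 by blast
  qed
  then obtain k where k: "prob (B k) \<noteq> 0" by blast
  define q where "q = 1 - 1 / (real k + 1)"
  have q: "0 \<le> q" "q < 1" by (auto simp: q_def field_simps)
  define A where "A = A0 \<inter> B k"
  have [measurable]: "A \<in> sets M" by (simp add: A_def)
  have A_Int: "prob (A \<inter> C) = (LINT x:B k \<inter> C|M. ?f x)" if C: "C \<in> sets (future 1)" for C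
  proof -
    have CM: "C \<in> sets M" using C subalgebra_future by (auto simp: subalgebra_def)
    have "prob (A \<inter> C) = (LINT x|M. indicator (A \<inter> C) x)" using CM by simp
    also have "\<dots> = (LINT x:B k \<inter> C|M. indicator A0 x)"
      unfolding set_lebesgue_integral_def
      by (intro Bochner_Integration.integral_cong) (auto simp: indicator_def A_def)
    also have "\<dots> = (LINT x:B k \<inter> C|M. ?f x)"
      using BF C by (intro F.real_cond_exp_intA[OF int]) auto
    finally show ?thesis .
  qed
  \<comment> \<open>The measure of \<open>A\<close> is the integral of \<open>?f\<close> over
    \<open>B k\<close>, where \<open>?f\<close> is strictly positive.\<close>
  have "prob A \<noteq> 0"
  proof
    assume "prob A = 0"
    then have "(LINT x:B k|M. ?f x) = 0"
      using A_Int[of "space M"] sets.top[of "future 1"] sets.sets_into_space[OF BM[of k]]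
        sets.sets_into_space[of A M] by (simp add: Int_absorb2)
    then have "(LINT x|M. indicator (B k) x * ?f x) = 0"
      by (simp add: set_lebesgue_integral_def)
    moreover have "integrable M (\<lambda>x. indicator (B k) x * ?f x)"
      using integrable_mult_indicator[OF BM intf, of k] by simp
    moreover have "AE x in M. 0 \<le> indicator (B k) x * ?f x"
      by (auto simp: indicator_def B_def)
    ultimately have "AE x in M. indicator (B k) x * ?f x = 0"
      by (simp add: integral_nonneg_eq_0_iff_AE)
    then have "AE x in M. x \<notin> B k"
      by eventually_elim (auto simp: indicator_def B_def split: if_splits)
    then have "B k \<in> null_sets M"
      using AE_iff_null_sets[OF BM] by simp
    then show False using k by (simp add: measure_def null_sets_def)
  qed
  then have "0 < prob A" by (simp add: zero_less_measure_iff)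
  \<comment> \<open>Conditionally on any event of the strict future, \<open>A\<close> has
    probability at most \<open>q\<close>, because \<open>?f \<le> q\<close> on
    \<open>B k\<close>.\<close>
  have A_Int_le: "prob (A \<inter> C) \<le> q * prob C" if C: "C \<in> sets (future 1)" for C
  proof -
    have CM [measurable]: "C \<in> sets M" using C subalgebra_future by (auto simp: subalgebra_def)
    have "prob (A \<inter> C) = (LINT x|M. indicator (B k \<inter> C) x * ?f x)"
      using A_Int[OF C] by (simp add: set_lebesgue_integral_def)
    also have "\<dots> \<le> (LINT x|M. q * indicator C x)"
    proof (rule integral_mono)
      show "integrable M (\<lambda>x. indicator (B k \<inter> C) x * ?f x)"
        using integrable_mult_indicator[of "B k \<inter> C", OF _ intf] by simp
      show "integrable M (\<lambda>x. q * indicat_real C x)"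
        by (simp add: emeasure_eq_measure)
      show "indicator (B k \<inter> C) x * ?f x \<le> q * indicator C x" for x
        using q by (auto simp: indicator_def B_def q_def)
    qed
    also have "\<dots> = q * prob C" by simp
    finally show ?thesis .
  qed
  have "A0 = (T ^^ 0) -` A0 \<inter> space M"
    using sets.sets_into_space[of A0 M] by auto
  then have "A0 \<in> sets (future 0)"
    unfolding sets_future using A0 by (intro sigma_sets.Basic) blast
  \<comment> \<open>Only the present label and the future enter into \<open>A\<close>, so its visits
    at times at least 1 are events of \<open>future 1\<close>.\<close>
  then have AF: "A \<in> sets (future 0)"
    using BF[of k] future_mono[of 0 1] by (auto simp: A_def)
  have "prob {x \<in> space M. \<forall>s\<in>S. (T ^^ s) x \<in> A} \<le> q ^ card S" if "finite S" for S
    using that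
  proof (induction "card S" arbitrary: S)
    case 0
    then show ?case by simp
  next
    case (Suc c)
    define s0 where "s0 = Min S"
    have "S \<noteq> {}" using Suc by auto
    then have s0: "s0 \<in> S" "\<And>s. s \<in> S \<Longrightarrow> s0 \<le> s"
      using Suc by (auto simp: s0_def)
    \<comment> \<open>The remaining times as seen from the first visit; all are at least 1, and
      minimality of \<open>s0\<close> keeps the truncated subtraction exact.\<close>
    define S' where "S' = (\<lambda>s. s - s0) ` (S - {s0})"
    have "inj_on (\<lambda>s. s - s0) (S - {s0})"
      using s0 by (auto simp: inj_on_def) (metis eq_diff_iff)
    then have card: "card S' = c"
      using Suc s0 by (simp add: S'_def card_image)
    have fin: "finite S'" using Suc by (simp add: S'_def)
    define C where "C = {x \<in> space M. \<forall>s\<in>S'. (T ^^ s) x \<in> A}"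
    have CF: "C \<in> sets (future 1)"
    proof -
      have "(T ^^ s) -` A \<inter> space M \<in> sets (future 1)" if "s \<in> S'" for s
      proof -
        have "1 \<le> s" using that s0 by (force simp: S'_def)
        then show ?thesis using future_shift[OF AF, of s] future_mono[of 1 s] by blast
      qed
      then have "{x \<in> space (future 1). \<forall>s\<in>S'. (T ^^ s) x \<in> A} \<in> sets (future 1)"
        using fin by (intro sets.sets_Collect_finite_All) (simp_all add: vimage_def Int_def conj_commute)
      then show ?thesis by (simp add: C_def)
    qed
    then have [measurable]: "C \<in> sets M" using subalgebra_future by (auto simp: subalgebra_def)
    have "{x \<in> space M. \<forall>s\<in>S. (T ^^ s) x \<in> A} = {x \<in> space M. (T ^^ s0) x \<in> A \<inter> C}"
    proof -
      have *: "(T ^^ (s - s0)) ((T ^^ s0) x) = (T ^^ s) x" if "s \<in> S" for s x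
        using s0(2)[OF that] by (metis funpow_add comp_apply le_add_diff_inverse2)
      have "(\<forall>s\<in>S. (T ^^ s) x \<in> A) \<longleftrightarrow> (T ^^ s0) x \<in> A \<and> (\<forall>s\<in>S'. (T ^^ s) ((T ^^ s0) x) \<in> A)" for x
        unfolding S'_def using s0(1) * by auto
      then show ?thesis by (auto simp: C_def)
    qed
    then have "prob {x \<in> space M. \<forall>s\<in>S. (T ^^ s) x \<in> A} = prob {x \<in> space M. x \<in> A \<inter> C}"
      by (simp only:) (rule measure_T_pow_Collect, simp)
    also have "{x \<in> space M. x \<in> A \<inter> C} = A \<inter> C"
      by (auto simp: C_def)
    also have "prob (A \<inter> C) \<le> q * prob C" by (rule A_Int_le[OF CF])
    also have "\<dots> \<le> q * q ^ card S'"
      using Suc.hyps(1)[of S'] card fin q by (intro mult_left_mono) (auto simp: C_def)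
    also have "\<dots> = q ^ card S" using card Suc by (metis power_Suc)
    finally show ?case .
  qed
  then show ?thesis
    using \<open>0 < prob A\<close> q by (intro exI[of _ A] exI[of _ q]) auto
qed

end

section \<open>Frequency of visits\<close>

text \<open>Summation by parts: the weighted sum is a combination of the partial sums with
  nonnegative coefficients, the decrements of \<open>w\<close> and its last value.\<close>

lemma sum_antimono_weights_nonneg:
  fixes w d :: "nat \<Rightarrow> real"
  assumes anti: "\<And>i j. i \<le> j \<Longrightarrow> j < N \<Longrightarrow> w j \<le> w i"
    and nonneg: "\<And>j. j < N \<Longrightarrow> 0 \<le> w j"
    and partial: "\<And>J. J \<le> N \<Longrightarrow> 0 \<le> (\<Sum>j<J. d j)"
  shows "0 \<le> (\<Sum>j<N. w j * d j)"
proof (cases N)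
  case (Suc n)
  have "w k * (\<Sum>j<Suc k. d j) \<le> (\<Sum>j<Suc k. w j * d j)" if "k \<le> n" for k
    using that
  proof (induction k)
    case (Suc k)
    have "w (Suc k) * (\<Sum>j<Suc k. d j) \<le> w k * (\<Sum>j<Suc k. d j)"
      using Suc.prems \<open>N = Suc n\<close> by (intro mult_right_mono anti partial) auto
    also have "\<dots> \<le> (\<Sum>j<Suc k. w j * d j)"
      using Suc by simp
    finally show ?case
      by (simp add: distrib_left)
  qed simp
  from this[of n] have "w n * (\<Sum>j<N. d j) \<le> (\<Sum>j<N. w j * d j)" using Suc by simp
  moreover have "0 \<le> w n * (\<Sum>j<N. d j)"
    using nonneg[of n] partial[of N] Suc by simp
  ultimately show ?thesis by linarith
qed simp

text \<open>Since averages are taken over initial segments, the last index with a large average bounds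
  the number of all such indices; summation by parts then allows decreasing weights.\<close>

lemma weighted_maximal_inequality:
  fixes w :: "nat \<Rightarrow> real"
  assumes anti: "\<And>i j. i \<le> j \<Longrightarrow> j < N \<Longrightarrow> w j \<le> w i"
    and nonneg: "\<And>j. j < N \<Longrightarrow> 0 \<le> w j"
    and "0 < \<eta>"
  shows "(\<Sum>j<N. w j * of_bool (\<eta> * real (Suc j) < real (card {i. i \<le> j \<and> bad i})))
    \<le> (\<Sum>j<N. w j * of_bool (bad j)) / \<eta>"
proof -
  define b where "b j = card {i. i \<le> j \<and> bad i}" for j
  define u where "u j = (of_bool (\<eta> * real (Suc j) < real (b j)) :: real)" for j
  have "0 \<le> (\<Sum>j<N. w j * (of_bool (bad j) - \<eta> * u j))"
  proof (rule sum_antimono_weights_nonneg[OF anti nonneg])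
    fix J
    let ?L = "{j. j < J \<and> \<eta> * real (Suc j) < real (b j)}"
    have sum_u: "(\<Sum>j<J. u j) = real (card ?L)"
      by (simp add: u_def sum.If_cases of_bool_def Int_def)
    have sum_bad: "(\<Sum>j<J. of_bool (bad j)) = real (card {i. i < J \<and> bad i})"
      by (simp add: sum.If_cases of_bool_def Int_def)
    have "\<eta> * real (card ?L) \<le> real (card {i. i < J \<and> bad i})"
    proof (cases "?L = {}")
      case False
      define k where "k = Max ?L"
      have k: "k < J" "\<eta> * real (Suc k) < real (b k)"
        using Max_in[of ?L] False by (auto simp: k_def)
      have "?L \<subseteq> {..k}"
        using Max_ge[of ?L] by (auto simp: k_def)
      then have "card ?L \<le> Suc k"
        using card_mono[of "{..k}" ?L] by simp
      then have "\<eta> * real (card ?L) \<le> \<eta> * real (Suc k)"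
        using \<open>0 < \<eta>\<close> by (intro mult_left_mono) auto
      also have "\<dots> \<le> real (b k)" using k by simp
      also have "b k \<le> card {i. i < J \<and> bad i}"
        unfolding b_def using k by (intro card_mono) auto
      finally show ?thesis by simp
    next
      case True
      then show ?thesis by (simp only: card.empty of_nat_0 mult_zero_right of_nat_0_le_iff)
    qed
    then show "0 \<le> (\<Sum>j<J. of_bool (bad j) - \<eta> * u j)"
      by (simp add: sum_subtractf sum_distrib_left[symmetric] sum_u sum_bad)
  qed
  also have "\<dots> = (\<Sum>j<N. w j * of_bool (bad j)) - \<eta> * (\<Sum>j<N. w j * u j)"
    by (simp add: sum_subtractf sum_distrib_left right_diff_distrib mult.left_commute)
  finally show ?thesis
    using \<open>0 < \<eta>\<close> by (simp add: pos_le_divide_eq mult.commute u_def b_def)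
qed

text \<open>Sort a listing of \<open>S\<close> by negated weight. The order of the type
  \<open>'b\<close> serves to produce the listing.\<close>

lemma exists_antimono_enumeration:
  fixes w :: "'b::linorder \<Rightarrow> real"
  assumes "finite S"
  shows "\<exists>e. bij_betw e {..<card S} S \<and> (\<forall>i j. i \<le> j \<longrightarrow> j < card S \<longrightarrow> w (e j) \<le> w (e i))"
proof -
  define xs where "xs = sort_key (\<lambda>s. - w s) (sorted_list_of_set S)"
  have xs: "set xs = S" "distinct xs" "length xs = card S"
    using assms by (auto simp: xs_def)
  have "sorted (map (\<lambda>s. - w s) xs)" by (simp add: xs_def)
  then have "\<forall>i j. i \<le> j \<longrightarrow> j < card S \<longrightarrow> w (xs ! j) \<le> w (xs ! i)"
    using xs by (auto simp: sorted_iff_nth_mono)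
  moreover have "bij_betw ((!) xs) {..<card S} S"
    using xs by (intro bij_betw_nth) auto
  ultimately show ?thesis by blast
qed

text \<open>The assumptions are what \<open>exists_unpredictable_set\<close> delivers; from here on
  the partition is left behind.\<close>

locale unpredictable_set = automorphism M T for M :: "'a measure" and T +
  fixes A :: "'a set" and q :: real
  assumes A_sets [measurable]: "A \<in> sets M"
    and A_pos: "0 < prob A"
    and q: "0 \<le> q" "q < 1"
    and visits: "finite S \<Longrightarrow> prob {x \<in> space M. \<forall>s\<in>S. (T ^^ s) x \<in> A} \<le> q ^ card S"
begin

text \<open>Shifting all times by their minimum makes them natural numbers, and invariance of the
  measure keeps the probability.\<close>

lemma visits_U:
  assumes "finite S"
  shows "prob {x \<in> space M. \<forall>s\<in>S. U s x \<in> A} \<le> q ^ card S"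
proof (cases "S = {}")
  case False
  define m where "m = Min S"
  have m: "m \<le> s" if "s \<in> S" for s using assms that by (simp add: m_def)
  define S' where "S' = (\<lambda>s. nat (s - m)) ` S"
  have fin [measurable]: "finite S'" using assms by (simp add: S'_def)
  have inj: "inj_on (\<lambda>s. nat (s - m)) S"
    using m by (intro inj_onI) (smt (verit) eq_nat_nat_iff)
  have *: "U s x = (T ^^ nat (s - m)) (U m x)" if "s \<in> S" "x \<in> space M" for s x
    using U_add[of x "s - m" m] U_of_nat[of "nat (s - m)"] m[OF that(1)] that(2) by simp
  have "{x \<in> space M. \<forall>s\<in>S. U s x \<in> A} = {x \<in> space M. \<forall>s\<in>S'. (T ^^ s) (U m x) \<in> A}"
    using * by (auto simp: S'_def)
  then have "prob {x \<in> space M. \<forall>s\<in>S. U s x \<in> A} = prob {x \<in> space M. \<forall>s\<in>S'. (T ^^ s) x \<in> A}"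
    by (simp only:) (rule measure_U_Collect, measurable)
  also have "\<dots> \<le> q ^ card S'" by (rule visits[OF fin])
  also have "card S' = card S" unfolding S'_def by (rule card_image[OF inj])
  finally show ?thesis .
qed simp

lemma borel_measurable_card_visits:
  assumes "finite S"
  shows "(\<lambda>x. real (card {s \<in> S. U s x \<in> A})) \<in> borel_measurable M"
proof -
  have "real (card {s \<in> S. U s x \<in> A}) = (\<Sum>s\<in>S. of_bool (U s x \<in> A))" for x
    using assms by (simp add: sum.If_cases of_bool_def Int_def)
  then show ?thesis by simp
qed

text \<open>Each visit contributes a factor \<open>1 + 1\<close> and each miss a factor
  \<open>0 + 1\<close>. Expanding the product over subsets \<open>R\<close> and bounding each term
  by \<open>q ^ card R\<close> gives a sum that refolds to \<open>(1 + q) ^ card S\<close>.\<close>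

lemma exponential_moment:
  assumes "finite S"
  shows "(LINT x|M. 2 ^ card {s \<in> S. U s x \<in> A}) \<le> (1 + q) ^ card S"
    and "integrable M (\<lambda>x. 2 ^ card {s \<in> S. U s x \<in> A} :: real)"
proof -
  have meas: "{x \<in> space M. \<forall>s\<in>R. U s x \<in> A} \<in> sets M" if "R \<in> Pow S" for R
  proof -
    have [measurable]: "finite R" using assms that finite_subset by auto
    show ?thesis by measurable
  qed
  have prod: "(2::real) ^ card {s \<in> S. U s x \<in> A} = (\<Sum>R\<in>Pow S. indicator {x \<in> space M. \<forall>s\<in>R. U s x \<in> A} x)"
    if x: "x \<in> space M" for x
  proof -
    have "(2::real) ^ card {s \<in> S. U s x \<in> A} = (\<Prod>s\<in>S. if U s x \<in> A then 2 else 1)"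
      using assms by (simp add: prod.If_cases Int_def)
    also have "\<dots> = (\<Prod>s\<in>S. of_bool (U s x \<in> A) + 1)"
      by (intro prod.cong) auto
    also have "\<dots> = (\<Sum>R\<in>Pow S. \<Prod>s\<in>R. of_bool (U s x \<in> A))"
      using assms by (subst prod_add) auto
    also have "\<dots> = (\<Sum>R\<in>Pow S. indicator {x \<in> space M. \<forall>s\<in>R. U s x \<in> A} x)"
    proof (rule sum.cong)
      fix R assume "R \<in> Pow S"
      then have "finite R" using assms finite_subset by auto
      then show "(\<Prod>s\<in>R. of_bool (U s x \<in> A)) = indicat_real {x \<in> space M. \<forall>s\<in>R. U s x \<in> A} x"
        using x by (cases "\<forall>s\<in>R. U s x \<in> A") (auto simp: indicator_def)
    qed simp
    finally show ?thesis .
  qed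
  have int: "integrable M (\<lambda>x. \<Sum>R\<in>Pow S. indicat_real {x \<in> space M. \<forall>s\<in>R. U s x \<in> A} x)"
    using meas by (intro Bochner_Integration.integrable_sum) (simp add: emeasure_eq_measure)
  show "integrable M (\<lambda>x. 2 ^ card {s \<in> S. U s x \<in> A} :: real)"
    using int by (subst Bochner_Integration.integrable_cong[OF refl prod]) 
  have "(LINT x|M. 2 ^ card {s \<in> S. U s x \<in> A}) =
      (LINT x|M. (\<Sum>R\<in>Pow S. indicat_real {x \<in> space M. \<forall>s\<in>R. U s x \<in> A} x))"
    by (rule Bochner_Integration.integral_cong[OF refl prod])
  also have "\<dots> = (\<Sum>R\<in>Pow S. (LINT x|M. indicat_real {x \<in> space M. \<forall>s\<in>R. U s x \<in> A} x))"
    using meas by (intro Bochner_Integration.integral_sum) (simp add: emeasure_eq_measure)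
  also have "\<dots> = (\<Sum>R\<in>Pow S. prob {x \<in> space M. \<forall>s\<in>R. U s x \<in> A})"
    using meas by (intro sum.cong) simp_all
  also have "\<dots> \<le> (\<Sum>R\<in>Pow S. q ^ card R)"
    using assms finite_subset by (intro sum_mono visits_U) auto
  also have "\<dots> = (\<Prod>s\<in>S. q + 1)"
    using assms by (subst prod_add) auto
  finally show "(LINT x|M. 2 ^ card {s \<in> S. U s x \<in> A}) \<le> (1 + q) ^ card S"
    by (simp add: add.commute)
qed

text \<open>A Chernoff bound: Markov's inequality for the exponential moment with base 2, whose
  growth rate \<open>1 + q\<close> is strictly below 2.\<close>

lemma frequent_visits:
  "\<exists>\<eta> \<kappa>. 0 < \<eta> \<and> 0 < \<kappa> \<and> \<kappa> < 1 \<and>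
    (\<forall>S. finite S \<longrightarrow>
      prob {x \<in> space M. (1 - \<eta>) * real (card S) \<le> real (card {s \<in> S. U s x \<in> A})} \<le> \<kappa> ^ card S)"
proof -
  define l where "l = log 2 (1 + q)"
  have l: "l < 1" "2 powr l = 1 + q"
    using q by (auto simp: l_def log_less_one_cancel_iff powr_log_cancel)
  \<comment> \<open>The gap \<open>1 - l\<close> is split in half: one half is the tolerated
    frequency of misses, the other becomes the decay rate \<open>\<kappa>\<close>, as
    \<open>l = (1 - \<eta>) + (l - 1) / 2\<close>.\<close>
  define \<eta> where "\<eta> = (1 - l) / 2"
  define \<kappa> where "\<kappa> = 2 powr ((l - 1) / 2)"
  have \<kappa>: "0 < \<kappa>" "\<kappa> < 1" using l by (auto simp: \<kappa>_def powr_less_one)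
  have "prob {x \<in> space M. (1 - \<eta>) * real (card S) \<le> real (card {s \<in> S. U s x \<in> A})} \<le> \<kappa> ^ card S"
    (is "prob ?F \<le> _") if [measurable]: "finite S" for S
  proof -
    let ?c = "\<lambda>x. card {s \<in> S. U s x \<in> A}"
    define z where "z = 2 powr ((1 - \<eta>) * real (card S))"
    have "0 < z" by (simp add: z_def)
    note borel_measurable_card_visits [OF that, measurable]
    have F [measurable]: "?F \<in> sets M" by measurable
    have "z * prob ?F = (LINT x|M. z * indicator ?F x)" by simp
    also have "\<dots> \<le> (LINT x|M. 2 ^ ?c x)"
    proof (rule integral_mono)
      show "integrable M (\<lambda>x. z * indicator ?F x)" by (simp add: emeasure_eq_measure)
      show "integrable M (\<lambda>x. 2 ^ ?c x :: real)" by (rule exponential_moment(2)[OF that])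
      fix x
      show "z * indicator ?F x \<le> 2 ^ ?c x"
      proof (cases "x \<in> ?F")
        case True
        then have "z \<le> 2 powr real (?c x)" unfolding z_def by (intro powr_mono) auto
        with True show ?thesis by (simp add: powr_realpow)
      qed simp
    qed
    also have "\<dots> \<le> (1 + q) ^ card S" by (rule exponential_moment(1)[OF that])
    also have "\<dots> = z * \<kappa> ^ card S"
    proof -
      have "(1 + q) ^ card S = 2 powr (l * real (card S))"
        using l(2) by (metis powr_powr powr_realpow powr_gt_zero zero_neq_numeral)
      also have "l * real (card S) = (1 - \<eta>) * real (card S) + (l - 1) / 2 * real (card S)"
        by (simp add: \<eta>_def field_simps)
      also have "2 powr \<dots> = z * 2 powr ((l - 1) / 2 * real (card S))"
        by (simp add: powr_add z_def)
      also have "2 powr ((l - 1) / 2 * real (card S)) = \<kappa> ^ card S"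
        unfolding \<kappa>_def by (metis powr_powr powr_realpow powr_gt_zero zero_neq_numeral)
      finally show ?thesis .
    qed
    finally show ?thesis using \<open>0 < z\<close> by simp
  qed
  moreover have "0 < \<eta>" using l by (simp add: \<eta>_def)
  ultimately show ?thesis using \<kappa> by blast
qed

section \<open>Cutting the set into small pieces by visit times\<close>

definition visit_times :: "nat \<Rightarrow> 'a \<Rightarrow> nat set" where
  "visit_times L x = {j \<in> {1..L}. (T ^^ j) x \<in> A}"

lemma finite_visit_times [simp]: "finite (visit_times L x)"
  by (simp add: visit_times_def)

lemma card_visit_times: "real (card (visit_times L x)) = (\<Sum>j=1..L. of_bool ((T ^^ j) x \<in> A))"
  by (simp add: visit_times_def sum.If_cases of_bool_def Int_def)

lemma few_visits_sets [measurable]: "{x \<in> A. card (visit_times L x) < p} \<in> sets M"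
proof -
  have iff: "card (visit_times L x) < p \<longleftrightarrow> (\<Sum>j=1..L. of_bool ((T ^^ j) x \<in> A)) < real p" for x
    unfolding card_visit_times[symmetric] by (rule of_nat_less_iff[symmetric])
  have "{x \<in> A. card (visit_times L x) < p} = {x \<in> space M. x \<in> A \<and> card (visit_times L x) < p}"
    using sets.sets_into_space[OF A_sets] by auto
  then show ?thesis unfolding iff by simp
qed

text \<open>On an orbit segment of length \<open>Suc L\<close>, all entries into the set after the
  first one are visit times of the first, so there are at most \<open>p\<close> entries. Integrating
  this count over the starting point gives the bound.\<close>

lemma few_visits:
  "real (Suc L) * prob {x \<in> A. card (visit_times L x) < p} \<le> real p"
proof -
  let ?R = "{x \<in> A. card (visit_times L x) < p}"
  have count: "card {j. j < Suc L \<and> (T ^^ j) x \<in> ?R} \<le> p" (is "card ?J \<le> p") for x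
  proof (cases "?J = {}")
    case False
    define j0 where "j0 = Min ?J"
    have "j0 \<in> ?J" unfolding j0_def using False by (intro Min_in) auto
    have j0: "j0 \<le> j" if "j \<in> ?J" for j unfolding j0_def using that by (intro Min_le) auto
    let ?V = "visit_times L ((T ^^ j0) x)"
    have "j - j0 \<in> ?V" if "j \<in> ?J - {j0}" for j
    proof -
      have "j0 < j" using j0[of j] that by auto
      then have "(T ^^ (j - j0)) ((T ^^ j0) x) = (T ^^ j) x"
        by (metis funpow_add comp_apply le_add_diff_inverse2 less_imp_le)
      then show ?thesis using that \<open>j0 < j\<close> by (auto simp: visit_times_def)
    qed
    then have "(\<lambda>j. j - j0) ` (?J - {j0}) \<subseteq> ?V" by blast
    then have "card ((\<lambda>j. j - j0) ` (?J - {j0})) \<le> card ?V" by (intro card_mono) simp_all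
    moreover have "inj_on (\<lambda>j. j - j0) (?J - {j0})"
    proof (rule inj_onI)
      fix i j assume "i \<in> ?J - {j0}" "j \<in> ?J - {j0}" "i - j0 = j - j0"
      then show "i = j" using j0[of i] j0[of j] by auto
    qed
    ultimately have "card (?J - {j0}) \<le> card ?V" by (simp only: card_image)
    then have "card (?J - {j0}) < p" using \<open>j0 \<in> ?J\<close> by simp
    then show ?thesis using \<open>j0 \<in> ?J\<close> by (simp add: card_Diff_singleton)
  next
    case True
    then show ?thesis by (simp only: card.empty)
  qed
  have R: "{x \<in> space M. (T ^^ j) x \<in> ?R} \<in> sets M" for j
    by measurable
  have "real (Suc L) * prob ?R = (\<Sum>j<Suc L. prob {x \<in> space M. (T ^^ j) x \<in> ?R})"
  proof -
    have "{x \<in> space M. x \<in> ?R} = ?R"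
      using sets.sets_into_space[OF A_sets] by auto
    moreover have "prob {x \<in> space M. (T ^^ j) x \<in> ?R} = prob {x \<in> space M. x \<in> ?R}" for j
      by (rule measure_T_pow_Collect) measurable
    ultimately have "prob {x \<in> space M. (T ^^ j) x \<in> ?R} = prob ?R" for j
      by (simp only:)
    then show ?thesis by (simp only: sum_constant card_lessThan)
  qed
  also have "\<dots> = (\<Sum>j<Suc L. (LINT x|M. indicat_real {x \<in> space M. (T ^^ j) x \<in> ?R} x))"
    using R by simp
  also have "\<dots> = (LINT x|M. (\<Sum>j<Suc L. indicat_real {x \<in> space M. (T ^^ j) x \<in> ?R} x))"
    using R by (intro Bochner_Integration.integral_sum[symmetric]) (simp add: emeasure_eq_measure)
  also have "\<dots> \<le> (LINT x|M. real p)"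
  proof (rule integral_mono)
    show "integrable M (\<lambda>x. \<Sum>j<Suc L. indicat_real {x \<in> space M. (T ^^ j) x \<in> ?R} x)"
      using R by (intro Bochner_Integration.integrable_sum) (simp add: emeasure_eq_measure)
    fix x assume "x \<in> space M"
    then have "(\<Sum>j<Suc L. indicat_real {x \<in> space M. (T ^^ j) x \<in> ?R} x) =
        (\<Sum>j<Suc L. if (T ^^ j) x \<in> ?R then 1 else 0)"
      by (intro sum.cong) (auto simp: indicator_def)
    also have "\<dots> = real (card {j. j < Suc L \<and> (T ^^ j) x \<in> ?R})"
      by (simp only: sum.If_cases finite_lessThan sum_constant)
         (simp add: Int_def)
    finally show "(\<Sum>j<Suc L. indicat_real {x \<in> space M. (T ^^ j) x \<in> ?R} x) \<le> real p"
      using count[of x] by simp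
  qed simp
  also have "\<dots> = real p" by (simp add: prob_space)
  finally show ?thesis .
qed

text \<open>The pieces collect the points of \<open>A\<close> with the same visit times in \<open>{1..L}\<close>.\<close>

lemma exists_small_pieces:
  assumes "0 < \<theta>"
  shows "\<exists>F r. (\<forall>i\<in>{1..r::nat}. F i \<in> sets M \<and> F i \<subseteq> A \<and> prob (F i) \<le> \<theta>) \<and>
     disjoint_family_on F {1..r} \<and> prob A / 2 \<le> prob (\<Union>i\<in>{1..r}. F i)"
proof -
  \<comment> \<open>Points with at least \<open>p\<close> prescribed visits form a set of measure at
    most \<open>q ^ p\<close>; \<open>L\<close> is then taken so large that at most half of
    \<open>A\<close> has fewer than \<open>p\<close> visits.\<close>
  obtain p where "q ^ p < \<theta>"
    using real_arch_pow_inv[OF assms q(2)] by blast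
  obtain L :: nat where "real p / (prob A / 2) < real L"
    using reals_Archimedean2 by blast
  then have "real p < real L * (prob A / 2)"
    using A_pos by (simp add: field_simps)
  moreover have "real L * prob {x \<in> A. card (visit_times L x) < p} \<le>
      real (Suc L) * prob {x \<in> A. card (visit_times L x) < p}"
    by (intro mult_right_mono) auto
  ultimately have "real L * prob {x \<in> A. card (visit_times L x) < p} < real L * (prob A / 2)"
    using few_visits[of L p] by linarith
  then have few: "prob {x \<in> A. card (visit_times L x) < p} \<le> prob A / 2"
    using mult_left_less_imp_less[OF _ of_nat_0_le_iff] by (blast intro: less_imp_le)
  define C where "C = {c. c \<subseteq> {1..L} \<and> p \<le> card c}"
  define r where "r = card C"
  have "finite C" unfolding C_def by simp
  then obtain h where h: "bij_betw h {1..r} C"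
    using ex_bij_betw_nat_finite_1 r_def by blast
  then have hC: "h i \<subseteq> {1..L}" "p \<le> card (h i)" if "i \<in> {1..r}" for i
    using bij_betwE[OF h] that by (auto simp: C_def)
  define F where "F i = {x \<in> A. visit_times L x = h i}" for i
  have A_space: "A \<subseteq> space M" using sets.sets_into_space[OF A_sets] .
  have F_sets: "F i \<in> sets M" if "i \<in> {1..r}" for i
  proof -
    have "visit_times L x = h i \<longleftrightarrow> (\<forall>j\<in>{1..L}. (T ^^ j) x \<in> A \<longleftrightarrow> j \<in> h i)" for x
      using hC(1)[OF that] unfolding visit_times_def by blast
    then have "F i = {x \<in> space M. x \<in> A \<and> (\<forall>j\<in>{1..L}. (T ^^ j) x \<in> A \<longleftrightarrow> j \<in> h i)}"
      using A_space unfolding F_def by (simp only:) blast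
    then show ?thesis by simp
  qed
  moreover have "prob (F i) \<le> \<theta>" if "i \<in> {1..r}" for i
  proof -
    have fin [measurable]: "finite (h i)" using hC(1)[OF that] finite_subset by blast
    have "prob (F i) \<le> prob {x \<in> space M. \<forall>s\<in>h i. (T ^^ s) x \<in> A}"
    proof (rule finite_measure_mono)
      show "F i \<subseteq> {x \<in> space M. \<forall>s\<in>h i. (T ^^ s) x \<in> A}"
        using A_space unfolding F_def visit_times_def by blast
      show "{x \<in> space M. \<forall>s\<in>h i. (T ^^ s) x \<in> A} \<in> sets M" by measurable
    qed
    also have "\<dots> \<le> q ^ card (h i)" by (rule visits[OF fin])
    also have "\<dots> \<le> q ^ p" using hC(2)[OF that] q by (intro power_decreasing) auto
    finally show ?thesis using \<open>q ^ p < \<theta>\<close> by simp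
  qed
  moreover have "F i \<subseteq> A" for i by (auto simp: F_def)
  moreover have "disjoint_family_on F {1..r}"
    unfolding disjoint_family_on_def
  proof (intro ballI impI)
    fix i j assume ij: "i \<in> {1..r}" "j \<in> {1..r}" "i \<noteq> j"
    then have "h i \<noteq> h j" using bij_betw_imp_inj_on[OF h] inj_on_eq_iff by metis
    then show "F i \<inter> F j = {}" unfolding F_def by blast
  qed
  moreover have "prob A / 2 \<le> prob (\<Union>i\<in>{1..r}. F i)"
  proof -
    have "(\<Union>i\<in>{1..r}. F i) = A - {x \<in> A. card (visit_times L x) < p}"
    proof (intro equalityI subsetI)
      fix x assume "x \<in> (\<Union>i\<in>{1..r}. F i)"
      then obtain i where "i \<in> {1..r}" "x \<in> A" "visit_times L x = h i" by (auto simp: F_def)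
      then show "x \<in> A - {x \<in> A. card (visit_times L x) < p}"
        using hC(2)[of i] by simp
    next
      fix x assume x: "x \<in> A - {x \<in> A. card (visit_times L x) < p}"
      then have "visit_times L x \<in> C" by (auto simp: C_def visit_times_def)
      then obtain i where "i \<in> {1..r}" "visit_times L x = h i"
        using bij_betw_imp_surj_on[OF h] by auto
      then show "x \<in> (\<Union>i\<in>{1..r}. F i)" using x by (auto simp: F_def)
    qed
    then have "prob (\<Union>i\<in>{1..r}. F i) = prob A - prob {x \<in> A. card (visit_times L x) < p}"
      by (simp only:) (intro finite_measure_Diff, auto)
    with few show ?thesis by simp
  qed
  ultimately show ?thesis by (intro exI[of _ F] exI[of _ r]) auto
qed

end

section \<open>Shifted masses\<close>

context automorphism
begin

text \<open>A normal form of the approximation: the functions are nonnegative everywhere, one finite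
  set \<open>S\<close> contains the shifts of all of them, and coefficients of equal shifts are
  merged.\<close>

lemma AT_finite_sums:
  fixes r :: nat and f :: "nat \<Rightarrow> 'a \<Rightarrow> real"
  assumes AT: "AT n M T" and "0 < \<epsilon>" and f: "\<And>i. i \<in> {1..r} \<Longrightarrow> f i \<in> L1_plus M"
  shows "\<exists>g S \<beta>. finite S \<and> (\<forall>m\<in>{1..n}. integrable M (g m) \<and> (\<forall>x. 0 \<le> g m x)) \<and>
    (\<forall>m\<in>{1..n}. \<forall>i\<in>{1..r}. \<forall>s. 0 \<le> \<beta> m i s) \<and>
    (\<forall>i\<in>{1..r}. (LINT x|M. \<bar>f i x - (\<Sum>m=1..n. \<Sum>s\<in>S. \<beta> m i s * g m (U s x))\<bar>) < \<epsilon>)"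
proof -
  have f': "\<forall>i\<in>{1..r}. f i \<in> L1_plus M" using f by blast
  from AT[unfolded AT_def, THEN spec, THEN mp, OF \<open>0 < \<epsilon>\<close>, THEN spec, THEN spec, THEN mp, OF f']
  obtain g0 :: "nat \<Rightarrow> 'a \<Rightarrow> real" and N :: nat and \<alpha> t where g0: "\<forall>m\<in>{1..n}. g0 m \<in> L1_plus M" and "0 < N"
    and \<alpha>: "\<forall>m\<in>{1..n}. \<forall>i\<in>{1..r}. \<forall>j\<in>{1..N}. 0 \<le> \<alpha> m i j"
    and approx: "\<forall>i\<in>{1..r}.
      (LINT x|M. \<bar>f i x - (\<Sum>m=1..n. \<Sum>j=1..N. \<alpha> m i j * g0 m (U (t m j) x))\<bar>) < \<epsilon>"
    by (elim exE conjE) (rule that)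
  note g0 = g0[rule_format] and \<alpha> = \<alpha>[rule_format] and approx = approx[rule_format]
  define g where "g m x = max 0 (g0 m x)" for m x
  define S where "S = (\<lambda>(m, j). t m j) ` ({1..n} \<times> {1..N})"
  \<comment> \<open>An empty sum, hence 0, when \<open>s\<close> is a shift of another function
    only.\<close>
  define \<beta> where "\<beta> m i s = (\<Sum>j\<in>{j \<in> {1..N}. t m j = s}. \<alpha> m i j)" for m i s
  have g: "integrable M (g m)" if "m \<in> {1..n}" for m
    using g0[OF that] by (auto simp: g_def[abs_def] L1_plus_def)
  have [measurable]: "g0 m \<in> borel_measurable M" if "m \<in> {1..n}" for m
    using g0[OF that] by (auto simp: L1_plus_def)
  have [measurable]: "g m \<in> borel_measurable M" if "m \<in> {1..n}" for m
    using g[OF that] by auto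
  have "finite S" by (simp add: S_def)
  have merge: "(\<Sum>s\<in>S. \<beta> m i s * g m (U s x)) = (\<Sum>j=1..N. \<alpha> m i j * g m (U (t m j) x))"
    if "m \<in> {1..n}" for m i x
  proof -
    have "(\<Sum>s\<in>S. \<beta> m i s * g m (U s x)) =
        (\<Sum>s\<in>S. \<Sum>j\<in>{j \<in> {1..N}. t m j = s}. \<alpha> m i j * g m (U (t m j) x))"
      unfolding \<beta>_def sum_distrib_right by (intro sum.cong refl) auto
    also have "\<dots> = (\<Sum>j=1..N. \<alpha> m i j * g m (U (t m j) x))"
      using that \<open>finite S\<close> by (intro sum.group) (auto simp: S_def)
    finally show ?thesis .
  qed
  have AE_eq: "AE x in M. \<forall>m\<in>{1..n}. \<forall>j\<in>{1..N}. g m (U (t m j) x) = g0 m (U (t m j) x)"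
  proof (intro AE_finite_allI finite_atLeastAtMost)
    fix m j assume "m \<in> {1..n}" "j \<in> {1..N}"
    then have "AE x in M. g m x = g0 m x"
      using g0[of m] by (auto simp: L1_plus_def g_def)
    then show "AE x in M. g m (U (t m j) x) = g0 m (U (t m j) x)" by (rule AE_U)
  qed
  have "(LINT x|M. \<bar>f i x - (\<Sum>m=1..n. \<Sum>s\<in>S. \<beta> m i s * g m (U s x))\<bar>) < \<epsilon>" if i: "i \<in> {1..r}" for i
  proof -
    have [measurable]: "f i \<in> borel_measurable M" using f[OF i] by (auto simp: L1_plus_def)
    have "(LINT x|M. \<bar>f i x - (\<Sum>m=1..n. \<Sum>s\<in>S. \<beta> m i s * g m (U s x))\<bar>) =
        (LINT x|M. \<bar>f i x - (\<Sum>m=1..n. \<Sum>j=1..N. \<alpha> m i j * g0 m (U (t m j) x))\<bar>)"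
    proof (rule integral_cong_AE)
      show "AE x in M. \<bar>f i x - (\<Sum>m=1..n. \<Sum>s\<in>S. \<beta> m i s * g m (U s x))\<bar> =
          \<bar>f i x - (\<Sum>m=1..n. \<Sum>j=1..N. \<alpha> m i j * g0 m (U (t m j) x))\<bar>"
        using AE_eq by eventually_elim (simp add: merge)
    qed measurable
    also have "\<dots> < \<epsilon>" by (rule approx[OF i])
    finally show ?thesis .
  qed
  moreover have "0 \<le> \<beta> m i s" if "m \<in> {1..n}" "i \<in> {1..r}" for m i s
    unfolding \<beta>_def using \<alpha>[OF that] by (intro sum_nonneg) auto
  moreover have "0 \<le> g m x" for m x by (simp add: g_def)
  ultimately show ?thesis
    using \<open>finite S\<close> g by (intro exI[of _ g] exI[of _ S] exI[of _ \<beta>] conjI ballI allI) simp_all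
qed

text \<open>The measure of \<open>C\<close> under the density \<open>g\<close> composed with the
  shift by \<open>s\<close>; set functions make it possible to test the approximation on
  subsets.\<close>

definition shifted_mass :: "('a \<Rightarrow> real) \<Rightarrow> int \<Rightarrow> 'a set \<Rightarrow> real" where
  "shifted_mass g s C = (LINT x|M. indicator C x * g (U s x))"

lemma integrable_shifted:
  fixes g :: "'a \<Rightarrow> real"
  assumes "integrable M g" "C \<in> sets M"
  shows "integrable M (\<lambda>x. indicator C x * g (U s x))"
proof -
  have "integrable M (\<lambda>x. g (U s x))" using assms(1) by (subst integrable_U) auto
  from integrable_mult_indicator[OF assms(2) this] show ?thesis by simp
qed

text \<open>Change of variables by invariance: the shift moves from the density to the set, with
  opposite sign.\<close>

lemma shifted_mass_eq:
  assumes "integrable M g" and [measurable]: "C \<in> sets M"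
  shows "shifted_mass g s C = (LINT x|M. indicator C (U (- s) x) * g x)"
proof -
  have [measurable]: "g \<in> borel_measurable M" using assms by auto
  have "shifted_mass g s C = (LINT x|M. indicator C (U (- s) x) * g (U s (U (- s) x)))"
    unfolding shifted_mass_def by (rule integral_U[symmetric]) measurable
  also have "\<dots> = (LINT x|M. indicator C (U (- s) x) * g x)"
    by (intro Bochner_Integration.integral_cong) (auto simp flip: U_add)
  finally show ?thesis .
qed

lemma shifted_mass_space:
  assumes "integrable M g"
  shows "shifted_mass g s (space M) = (LINT x|M. g x)"
proof -
  have "shifted_mass g s (space M) = (LINT x|M. g (U s x))"
    unfolding shifted_mass_def by (intro Bochner_Integration.integral_cong) auto
  then show ?thesis using assms by (simp add: integral_U)
qed

lemma shifted_mass_nonneg: "(\<And>x. 0 \<le> g x) \<Longrightarrow> 0 \<le> shifted_mass g s C"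
  unfolding shifted_mass_def by (intro Bochner_Integration.integral_nonneg) auto

lemma shifted_mass_mono:
  assumes "integrable M g" "\<And>x. 0 \<le> g x" "C \<subseteq> D" "C \<in> sets M" "D \<in> sets M"
  shows "shifted_mass g s C \<le> shifted_mass g s D"
  unfolding shifted_mass_def using assms
  by (intro integral_mono integrable_shifted mult_right_mono) (auto simp: indicator_def)

lemma shifted_mass_Un:
  assumes "integrable M g" "C \<inter> D = {}" "C \<in> sets M" "D \<in> sets M"
  shows "shifted_mass g s (C \<union> D) = shifted_mass g s C + shifted_mass g s D"
proof -
  have "shifted_mass g s (C \<union> D) = (LINT x|M. indicator C x * g (U s x) + indicator D x * g (U s x))"
    unfolding shifted_mass_def using assms(2)
    by (intro Bochner_Integration.integral_cong) (auto simp: indicator_def)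
  then show ?thesis
    using assms by (simp add: integrable_shifted shifted_mass_def)
qed

end

text \<open>Telescoping: after multiplication by \<open>1 - \<kappa>\<close> each term is at most
  \<open>\<kappa> ^ j - \<kappa> ^ Suc j\<close>.\<close>

lemma sum_power_tail_le:
  fixes \<kappa> :: real
  assumes "0 < \<kappa>" "\<kappa> < 1"
  shows "(\<Sum>j=J..<N. \<kappa> ^ Suc j) \<le> \<kappa> ^ J / (1 - \<kappa>)"
proof -
  have "(\<Sum>j=J..<J + k. \<kappa> ^ Suc j) * (1 - \<kappa>) \<le> \<kappa> ^ J - \<kappa> ^ (J + k)" for k
  proof (induction k)
    case (Suc k)
    have "\<kappa> ^ Suc (J + k) * (1 - \<kappa>) \<le> \<kappa> ^ (J + k) * (1 - \<kappa>)"
      using assms by (intro mult_right_mono power_decreasing) auto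
    with Suc show ?case by (simp add: algebra_simps)
  qed simp
  from this[of "N - J"] have "(\<Sum>j=J..<N. \<kappa> ^ Suc j) * (1 - \<kappa>) \<le> \<kappa> ^ J"
    using assms by (cases "J \<le> N") (auto intro: order_trans)
  then show ?thesis using assms by (simp add: pos_le_divide_eq)
qed

section \<open>Upper bound for the total mass of an approximation\<close>

context unpredictable_set
begin

text \<open>In decreasing order of weight, the first \<open>J\<close> terms cost at most
  \<open>\<tau>\<close> each. In a later term, the part over points with many misses so far is paid
  for, by the maximal inequality, with the mass outside \<open>A\<close>. The rest lives on a set of
  exponentially small measure, covered by \<open>V\<close>.\<close>

lemma mass_bound_single:
  fixes g :: "'a \<Rightarrow> real" and \<gamma> :: "int \<Rightarrow> real"
  assumes S: "finite S" and g: "integrable M g" "\<And>x. 0 \<le> g x" and \<gamma>: "\<And>s. 0 \<le> \<gamma> s"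
    and \<tau>: "\<And>s. s \<in> S \<Longrightarrow> \<gamma> s * (LINT x|M. g x) \<le> \<tau>" "0 \<le> \<tau>"
    and "0 < \<eta>" and \<kappa>: "0 < \<kappa>" "\<kappa> < 1"
    and freq: "\<And>R. finite R \<Longrightarrow>
      prob {x \<in> space M. (1 - \<eta>) * real (card R) \<le> real (card {s \<in> R. U s x \<in> A})} \<le> \<kappa> ^ card R"
  shows "\<exists>V\<in>sets M. prob V \<le> \<kappa> ^ J / (1 - \<kappa>) \<and>
    (\<Sum>s\<in>S. \<gamma> s * shifted_mass g s (space M)) \<le>
      real J * \<tau> + (\<Sum>s\<in>S. \<gamma> s * shifted_mass g s (space M - A)) / \<eta> + (\<Sum>s\<in>S. \<gamma> s * shifted_mass g s V)"
proof -
  define N where "N = card S"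
  obtain e where e: "bij_betw e {..<N} S"
    and anti: "\<And>i j. i \<le> j \<Longrightarrow> j < N \<Longrightarrow> \<gamma> (e j) \<le> \<gamma> (e i)"
    using exists_antimono_enumeration[OF S, of \<gamma>] unfolding N_def by blast
  define w where "w j = \<gamma> (e j)" for j
  have w: "0 \<le> w j" for j using \<gamma> by (simp add: w_def)
  have reindex: "(\<Sum>s\<in>S. \<gamma> s * \<phi> s) = (\<Sum>j<N. w j * \<phi> (e j))" for \<phi>
    unfolding w_def by (rule sum.reindex_bij_betw[OF e, symmetric])
  have eS: "e j \<in> S" if "j < N" for j using bij_betwE[OF e] that by auto
  have [measurable]: "g \<in> borel_measurable M" using g by auto
  let ?I = "LINT x|M. g x"
  \<comment> \<open>Here \<open>y\<close> is a point at which \<open>g\<close> itself is evaluated;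
    for \<open>y = U (e j) x\<close> the condition says that \<open>x\<close> is outside
    \<open>A\<close>.\<close>
  define bad where "bad y j \<longleftrightarrow> U (- e j) y \<notin> A" for y j
  have [measurable]: "Measurable.pred M (\<lambda>y. bad y j)" for j
    unfolding bad_def by measurable
  define b where "b y j = real (card {i. i \<le> j \<and> bad y i})" for y j
  have b_eq: "b y j = (\<Sum>i\<le>j. of_bool (bad y i))" for y j
    by (simp add: b_def sum.If_cases of_bool_def Int_def)
  have [measurable]: "(\<lambda>y. b y j) \<in> borel_measurable M" for j
    unfolding b_eq by measurable
  \<comment> \<open>At most a fraction \<open>\<eta>\<close> of the first \<open>Suc j\<close> times
    are misses, which is the event that \<open>freq\<close> bounds for the negated times.\<close>
  define Y where "Y j = {y \<in> space M. b y j \<le> \<eta> * real (Suc j)}" for j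
  have [measurable]: "Y j \<in> sets M" for j unfolding Y_def by measurable
  have prob_Y: "prob (Y j) \<le> \<kappa> ^ Suc j" if "j < N" for j
  proof -
    define R where "R = (\<lambda>i. - e i) ` {..j}"
    have inj: "inj_on (\<lambda>i. - e i) {..j}"
      using bij_betw_imp_inj_on[OF e] that by (auto simp: inj_on_def)
    then have card_R: "card R = Suc j" unfolding R_def by (simp add: card_image)
    have card_good: "real (card {s \<in> R. U s y \<in> A}) = real (Suc j) - b y j" for y
    proof -
      have "{s \<in> R. U s y \<in> A} = (\<lambda>i. - e i) ` {i. i \<le> j \<and> \<not> bad y i}"
        by (auto simp: R_def bad_def)
      then have "card {s \<in> R. U s y \<in> A} = card {i. i \<le> j \<and> \<not> bad y i}"
        using inj by (simp only:) (intro card_image inj_on_subset[OF inj], auto)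
      moreover have "card {i. i \<le> j \<and> \<not> bad y i} + card {i. i \<le> j \<and> bad y i} = Suc j"
      proof -
        have "{i. i \<le> j \<and> \<not> bad y i} \<union> {i. i \<le> j \<and> bad y i} = {..j}" by auto
        then show ?thesis by (subst card_Un_disjoint[symmetric]) auto
      qed
      ultimately show ?thesis by (simp add: b_def)
    qed
    have Y_eq: "Y j = {x \<in> space M. (1 - \<eta>) * real (card R) \<le> real (card {s \<in> R. U s x \<in> A})}"
      unfolding Y_def card_R card_good by (intro Collect_cong) (auto simp: algebra_simps)
    have "finite R" by (simp add: R_def)
    from freq[OF this] show ?thesis unfolding Y_eq card_R .
  qed
  \<comment> \<open>The sets \<open>Y j\<close> moved back to where the \<open>j\<close>-th term
    places its mass; starting at \<open>J\<close> leaves only a geometric tail.\<close>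
  define V where "V = (\<Union>j\<in>{J..<N}. {x \<in> space M. U (e j) x \<in> Y j})"
  have V_sets [measurable]: "V \<in> sets M" unfolding V_def by measurable
  have "prob V \<le> (\<Sum>j=J..<N. prob {x \<in> space M. U (e j) x \<in> Y j})"
    unfolding V_def by (rule measure_UNION_le) auto
  also have "\<dots> \<le> (\<Sum>j=J..<N. \<kappa> ^ Suc j)"
  proof (rule sum_mono)
    fix j assume j: "j \<in> {J..<N}"
    have "prob {x \<in> space M. U (e j) x \<in> Y j} = prob {x \<in> space M. x \<in> Y j}"
      by (rule measure_U_Collect) measurable
    also have "{x \<in> space M. x \<in> Y j} = Y j" by (auto simp: Y_def)
    finally show "prob {x \<in> space M. U (e j) x \<in> Y j} \<le> \<kappa> ^ Suc j"
      using prob_Y[of j] j by simp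
  qed
  also have "\<dots> \<le> \<kappa> ^ J / (1 - \<kappa>)" by (rule sum_power_tail_le[OF \<kappa>])
  finally have prob_V: "prob V \<le> \<kappa> ^ J / (1 - \<kappa>)" .
  \<comment> \<open>The mass of \<open>g\<close> is split into the part \<open>P j\<close> off
    \<open>Y j\<close> and the part \<open>Q j\<close> on \<open>Y j\<close>.\<close>
  define P where "P j = (LINT y|M. of_bool (\<eta> * real (Suc j) < b y j) * g y)" for j
  define Q where "Q j = (LINT y|M. indicator (Y j) y * g y)" for j
  have int_bool: "integrable M (\<lambda>y. of_bool (\<phi> y) * g y)"
    if [measurable]: "Measurable.pred M \<phi>" for \<phi>
    by (rule Bochner_Integration.integrable_bound[OF g(1)]) (auto simp: of_bool_def)
  have PQ: "?I = P j + Q j" for j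
  proof -
    have "?I = (LINT y|M. of_bool (\<eta> * real (Suc j) < b y j) * g y + indicator (Y j) y * g y)"
      by (intro Bochner_Integration.integral_cong) (auto simp: Y_def indicator_def)
    also have "\<dots> = P j + Q j"
      unfolding P_def Q_def
      using integrable_mult_indicator[of "Y j", OF _ g(1)]
      by (intro Bochner_Integration.integral_add int_bool) auto
    finally show ?thesis .
  qed
  have P0: "0 \<le> P j" for j
    unfolding P_def using g by (intro Bochner_Integration.integral_nonneg) auto
  have P_sum: "(\<Sum>j<N. w j * P j) \<le> (\<Sum>s\<in>S. \<gamma> s * shifted_mass g s (space M - A)) / \<eta>"
  proof -
    have "(\<Sum>j<N. w j * P j) = (\<Sum>j<N. (LINT y|M. w j * (of_bool (\<eta> * real (Suc j) < b y j) * g y)))"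
      unfolding P_def by simp
    also have "\<dots> = (LINT y|M. (\<Sum>j<N. w j * (of_bool (\<eta> * real (Suc j) < b y j) * g y)))"
      by (intro Bochner_Integration.integral_sum[symmetric] integrable_mult_right int_bool) measurable
    also have "\<dots> \<le> (LINT y|M. (\<Sum>j<N. w j * (of_bool (bad y j) * g y)) / \<eta>)"
    proof (rule integral_mono)
      show "integrable M (\<lambda>y. \<Sum>j<N. w j * (of_bool (\<eta> * real (Suc j) < b y j) * g y))"
        by (intro Bochner_Integration.integrable_sum integrable_mult_right int_bool) measurable
      show "integrable M (\<lambda>y. (\<Sum>j<N. w j * (of_bool (bad y j) * g y)) / \<eta>)"
        by (intro integrable_divide Bochner_Integration.integrable_sum integrable_mult_right int_bool) measurable
      fix y
      have "(\<Sum>j<N. w j * of_bool (\<eta> * real (Suc j) < b y j)) \<le> (\<Sum>j<N. w j * of_bool (bad y j)) / \<eta>"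
        unfolding b_def using anti w \<open>0 < \<eta>\<close>
        by (intro weighted_maximal_inequality) (auto simp: w_def)
      from mult_right_mono[OF this g(2)[of y]]
      show "(\<Sum>j<N. w j * (of_bool (\<eta> * real (Suc j) < b y j) * g y)) \<le> (\<Sum>j<N. w j * (of_bool (bad y j) * g y)) / \<eta>"
        by (simp only: sum_distrib_right mult.assoc times_divide_eq_left)
    qed
    also have "\<dots> = (\<Sum>j<N. w j * (LINT y|M. of_bool (bad y j) * g y)) / \<eta>"
    proof -
      have "(LINT y|M. (\<Sum>j<N. w j * (of_bool (bad y j) * g y))) = (\<Sum>j<N. (LINT y|M. w j * (of_bool (bad y j) * g y)))"
        by (intro Bochner_Integration.integral_sum integrable_mult_right int_bool) measurable
      then show ?thesis by simp
    qed
    also have "(\<Sum>j<N. w j * (LINT y|M. of_bool (bad y j) * g y)) =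
        (\<Sum>j<N. w j * shifted_mass g (e j) (space M - A))"
    proof (intro sum.cong refl arg_cong2[where f = times])
      fix j
      have "shifted_mass g (e j) (space M - A) = (LINT y|M. indicator (space M - A) (U (- e j) y) * g y)"
        by (intro shifted_mass_eq g) auto
      also have "\<dots> = (LINT y|M. of_bool (bad y j) * g y)"
        by (intro Bochner_Integration.integral_cong) (auto simp: bad_def indicator_def)
      finally show "(LINT y|M. of_bool (bad y j) * g y) = shifted_mass g (e j) (space M - A)" ..
    qed
    finally show ?thesis by (simp only: reindex)
  qed
  have Q_sum: "(\<Sum>j=J..<N. w j * Q j) \<le> (\<Sum>s\<in>S. \<gamma> s * shifted_mass g s V)"
  proof -
    have "(\<Sum>j=J..<N. w j * Q j) \<le> (\<Sum>j=J..<N. w j * shifted_mass g (e j) V)"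
    proof (intro sum_mono mult_left_mono w)
      fix j assume j: "j \<in> {J..<N}"
      have "Q j = (LINT x|M. indicator (Y j) (U (e j) x) * g (U (e j) x))"
        unfolding Q_def by (rule integral_U[symmetric]) measurable
      also have "\<dots> = shifted_mass g (e j) {x \<in> space M. U (e j) x \<in> Y j}"
        unfolding shifted_mass_def
        by (intro Bochner_Integration.integral_cong) (auto simp: indicator_def)
      also have "\<dots> \<le> shifted_mass g (e j) V"
        using j by (intro shifted_mass_mono g) (auto simp: V_def)
      finally show "Q j \<le> shifted_mass g (e j) V" .
    qed
    also have "\<dots> \<le> (\<Sum>j<N. w j * shifted_mass g (e j) V)"
      using w g by (intro sum_mono2 mult_nonneg_nonneg shifted_mass_nonneg) auto
    finally show ?thesis by (simp only: reindex)
  qed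
  have "(\<Sum>s\<in>S. \<gamma> s * shifted_mass g s (space M)) = (\<Sum>j<N. w j * ?I)"
    by (simp only: reindex shifted_mass_space[OF g(1)])
  \<comment> \<open>The factor \<open>of_bool (j < N)\<close> cancels the surplus indices when
    \<open>J\<close> exceeds \<open>N\<close>.\<close>
  also have "\<dots> \<le> (\<Sum>j\<in>{..<J} \<union> {J..<N}. w j * ?I * of_bool (j < N))"
    by (rule eq_refl, rule sum.mono_neutral_cong_left) auto
  also have "\<dots> = (\<Sum>j<J. w j * ?I * of_bool (j < N)) + (\<Sum>j=J..<N. w j * ?I * of_bool (j < N))"
    by (rule sum.union_disjoint) auto
  also have "(\<Sum>j<J. w j * ?I * of_bool (j < N)) \<le> (\<Sum>j<J. \<tau>)"
    using \<tau> eS by (intro sum_mono) (auto simp: w_def)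
  also have "(\<Sum>j<J. \<tau>) = real J * \<tau>" by simp
  also have "(\<Sum>j=J..<N. w j * ?I * of_bool (j < N)) = (\<Sum>j=J..<N. w j * P j) + (\<Sum>j=J..<N. w j * Q j)"
    by (simp add: PQ[symmetric] distrib_left[symmetric] sum.distrib[symmetric])
  also have "(\<Sum>j=J..<N. w j * P j) \<le> (\<Sum>j<N. w j * P j)"
    using w P0 by (intro sum_mono2) auto
  finally show ?thesis
    using P_sum Q_sum prob_V V_sets by (intro bexI[of _ V]) auto
qed

text \<open>Sum the single bounds over \<open>m\<close>. Since \<open>H_le\<close> tests all
  functions on one common set, the exceptional sets \<open>V m\<close> are first enlarged to their
  union, whose measure is still small because there are only \<open>n\<close> of them.\<close>

lemma mass_bound:
  fixes g :: "nat \<Rightarrow> 'a \<Rightarrow> real" and \<gamma> :: "nat \<Rightarrow> int \<Rightarrow> real" and n J :: nat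
    and S :: "int set"
  defines "H \<equiv> \<lambda>C. \<Sum>m=1..n. \<Sum>s\<in>S. \<gamma> m s * shifted_mass (g m) s C"
  assumes S: "finite S"
    and g: "\<And>m. m \<in> {1..n} \<Longrightarrow> integrable M (g m)" "\<And>m x. m \<in> {1..n} \<Longrightarrow> 0 \<le> g m x"
    and \<gamma>: "\<And>m s. m \<in> {1..n} \<Longrightarrow> 0 \<le> \<gamma> m s"
    and \<tau>: "\<And>m s. m \<in> {1..n} \<Longrightarrow> s \<in> S \<Longrightarrow> \<gamma> m s * (LINT x|M. g m x) \<le> \<tau>" "0 \<le> \<tau>"
    and "0 < \<eta>" and \<kappa>: "0 < \<kappa>" "\<kappa> < 1"
    and freq: "\<And>R. finite R \<Longrightarrow>
      prob {x \<in> space M. (1 - \<eta>) * real (card R) \<le> real (card {s \<in> R. U s x \<in> A})} \<le> \<kappa> ^ card R"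
    and H_le: "\<And>C. C \<in> sets M \<Longrightarrow> H C \<le> prob C + \<delta>"
    and H_out: "H (space M - A) \<le> \<delta>"
  shows "H (space M) \<le> real n * (real J * \<tau>) + \<delta> / \<eta> + real n * (\<kappa> ^ J / (1 - \<kappa>)) + \<delta>"
proof -
  have "\<forall>m\<in>{1..n}. \<exists>V. V \<in> sets M \<and> prob V \<le> \<kappa> ^ J / (1 - \<kappa>) \<and>
      (\<Sum>s\<in>S. \<gamma> m s * shifted_mass (g m) s (space M)) \<le>
        real J * \<tau> + (\<Sum>s\<in>S. \<gamma> m s * shifted_mass (g m) s (space M - A)) / \<eta>
        + (\<Sum>s\<in>S. \<gamma> m s * shifted_mass (g m) s V)"
    (is "\<forall>m\<in>_. \<exists>V. ?Q m V")
  proof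
    fix m assume m: "m \<in> {1..n}"
    show "\<exists>V. ?Q m V"
      using mass_bound_single[where J = J, OF S g[OF m] \<gamma>[OF m] \<tau>(1)[OF m] \<tau>(2) \<open>0 < \<eta>\<close> \<kappa> freq]
      by (simp only: Bex_def)
  qed
  from bchoice[OF this]
  obtain V where V: "\<And>m. m \<in> {1..n} \<Longrightarrow> V m \<in> sets M"
    and prob_V: "\<And>m. m \<in> {1..n} \<Longrightarrow> prob (V m) \<le> \<kappa> ^ J / (1 - \<kappa>)"
    and bound: "\<And>m. m \<in> {1..n} \<Longrightarrow> (\<Sum>s\<in>S. \<gamma> m s * shifted_mass (g m) s (space M)) \<le>
        real J * \<tau> + (\<Sum>s\<in>S. \<gamma> m s * shifted_mass (g m) s (space M - A)) / \<eta>
        + (\<Sum>s\<in>S. \<gamma> m s * shifted_mass (g m) s (V m))"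
    by blast
  define W where "W = (\<Union>m\<in>{1..n}. V m)"
  have W: "W \<in> sets M" unfolding W_def using V by auto
  have "prob W \<le> (\<Sum>m=1..n. prob (V m))"
    unfolding W_def using V by (intro measure_UNION_le) auto
  also have "\<dots> \<le> (\<Sum>m=1..n. \<kappa> ^ J / (1 - \<kappa>))" by (rule sum_mono[OF prob_V])
  finally have prob_W: "prob W \<le> real n * (\<kappa> ^ J / (1 - \<kappa>))" by simp
  have "H (space M) \<le> (\<Sum>m=1..n. real J * \<tau> + (\<Sum>s\<in>S. \<gamma> m s * shifted_mass (g m) s (space M - A)) / \<eta>
        + (\<Sum>s\<in>S. \<gamma> m s * shifted_mass (g m) s (V m)))"
    unfolding H_def by (rule sum_mono[OF bound])
  also have "\<dots> \<le> (\<Sum>m=1..n. real J * \<tau> + (\<Sum>s\<in>S. \<gamma> m s * shifted_mass (g m) s (space M - A)) / \<eta>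
        + (\<Sum>s\<in>S. \<gamma> m s * shifted_mass (g m) s W))"
    using V W g \<gamma>
    by (intro sum_mono add_left_mono mult_left_mono shifted_mass_mono) (auto simp: W_def)
  also have "\<dots> = real n * (real J * \<tau>) + H (space M - A) / \<eta> + H W"
    by (simp add: H_def sum.distrib sum_divide_distrib)
  also have "H (space M - A) / \<eta> \<le> \<delta> / \<eta>"
    using H_out \<open>0 < \<eta>\<close> by (intro divide_right_mono) auto
  finally show ?thesis using H_le[OF W] prob_W by simp
qed

end

section \<open>Failure of AT\<close>

context unpredictable_set
begin

text \<open>With \<open>a = prob A\<close>, the approximations of the pieces have total mass at
  least \<open>a / 2 - \<delta>\<close>, while \<open>mass_bound\<close> together with the choice of
  constants gives at most \<open>3 * a / 16 - \<delta>\<close>.\<close>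

lemma not_AT: "\<not> AT n M T"
proof
  assume AT: "AT n M T"
  obtain \<eta> \<kappa> where \<eta>: "0 < \<eta>" and \<kappa>: "0 < \<kappa>" "\<kappa> < 1"
    and freq: "\<And>R. finite R \<Longrightarrow>
      prob {x \<in> space M. (1 - \<eta>) * real (card R) \<le> real (card {s \<in> R. U s x \<in> A})} \<le> \<kappa> ^ card R"
    using frequent_visits by blast
  define a where "a = prob A"
  have a: "0 < a" using A_pos by (simp add: a_def)
  \<comment> \<open>Makes the measure of the exceptional sets, summed over the \<open>n\<close>
    functions, at most \<open>a / 16\<close>.\<close>
  obtain J where J: "\<kappa> ^ J < a * (1 - \<kappa>) / (16 * (real n + 1))"
    using real_arch_pow_inv[of "a * (1 - \<kappa>) / (16 * (real n + 1))" \<kappa>] a \<kappa> by auto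
  \<comment> \<open>With \<open>2 * \<theta>\<close> as the bound on a single term, the first
    \<open>J\<close> terms of all \<open>n\<close> functions have mass at most
    \<open>a / 16\<close>.\<close>
  define \<theta> where "\<theta> = a / (32 * (real n + 1) * (real J + 1))"
  have \<theta>: "0 < \<theta>" using a by (simp add: \<theta>_def)
  obtain F and r :: nat where F: "\<And>i. i \<in> {1..r} \<Longrightarrow> F i \<in> sets M" "\<And>i. i \<in> {1..r} \<Longrightarrow> F i \<subseteq> A"
      "\<And>i. i \<in> {1..r} \<Longrightarrow> prob (F i) \<le> \<theta>"
    and disj: "disjoint_family_on F {1..r}"
    and big: "a / 2 \<le> prob (\<Union>i\<in>{1..r}. F i)"
    using exists_small_pieces[OF \<theta>] unfolding a_def by blast
  \<comment> \<open>The first entry keeps every term below \<open>2 * \<theta>\<close>; the second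
    gives \<open>2 * \<delta> + \<delta> / \<eta> \<le> a / 16\<close>.\<close>
  define \<delta> where "\<delta> = min (\<theta> / 3) (a / (16 * (2 + 1 / \<eta>)))"
  have \<delta>: "0 < \<delta>" using \<theta> a \<eta> by (simp add: \<delta>_def add_pos_pos)
  \<comment> \<open>The number of pieces is known before AT is invoked, so their \<open>r\<close>
    errors can be made to add up to at most \<open>\<delta>\<close>.\<close>
  define \<epsilon> where "\<epsilon> = \<delta> / (real r + 1)"
  have \<epsilon>: "0 < \<epsilon>" using \<delta> by (simp add: \<epsilon>_def)
  have r\<epsilon>: "real r * \<epsilon> \<le> \<delta>" "\<epsilon> \<le> \<delta>"
    using \<delta> by (auto simp: \<epsilon>_def field_simps)
  obtain g S \<beta> where S: "finite S"
    and g: "\<And>m. m \<in> {1..n} \<Longrightarrow> integrable M (g m)" "\<And>m x. m \<in> {1..n} \<Longrightarrow> 0 \<le> g m x"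
    and \<beta>: "\<And>m i s. m \<in> {1..n} \<Longrightarrow> i \<in> {1..r} \<Longrightarrow> 0 \<le> \<beta> m i s"
    and approx: "\<And>i. i \<in> {1..r} \<Longrightarrow>
      (LINT x|M. \<bar>indicator (F i) x - (\<Sum>m=1..n. \<Sum>s\<in>S. \<beta> m i s * g m (U s x))\<bar>) < \<epsilon>"
  proof -
    have "indicat_real (F i) \<in> L1_plus M" if "i \<in> {1..r}" for i
      using F(1)[OF that] by (simp add: L1_plus_def emeasure_eq_measure)
    then show ?thesis
      using AT_finite_sums[OF AT \<epsilon>, of r "\<lambda>i. indicat_real (F i)"] that by blast
  qed
  \<comment> \<open>Integrating over \<open>C\<close> costs no more than the L1 error, so the
    estimate is uniform in \<open>C\<close>.\<close>
  have close: "\<bar>(\<Sum>m=1..n. \<Sum>s\<in>S. \<beta> m i s * shifted_mass (g m) s C) - prob (F i \<inter> C)\<bar> \<le> \<epsilon>"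
    if i: "i \<in> {1..r}" and C [measurable]: "C \<in> sets M" for i C
  proof -
    let ?h = "\<lambda>x. \<Sum>m=1..n. \<Sum>s\<in>S. \<beta> m i s * g m (U s x)"
    have F_meas [measurable]: "F i \<in> sets M" using F(1)[OF i] .
    have int_gU: "integrable M (\<lambda>x. g m (U s x))" if "m \<in> {1..n}" for m s
      using g(1)[OF that] by (subst integrable_U) auto
    have int_h: "integrable M ?h"
      using int_gU by (intro Bochner_Integration.integrable_sum integrable_mult_right) auto
    have int_F: "integrable M (indicat_real (F i))" by (simp add: emeasure_eq_measure)
    have "(\<Sum>m=1..n. \<Sum>s\<in>S. \<beta> m i s * shifted_mass (g m) s C) =
        (\<Sum>m=1..n. \<Sum>s\<in>S. (LINT x|M. \<beta> m i s * (indicator C x * g m (U s x))))"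
      by (simp add: shifted_mass_def)
    also have "\<dots> = (\<Sum>m=1..n. (LINT x|M. (\<Sum>s\<in>S. \<beta> m i s * (indicator C x * g m (U s x)))))"
      using g by (intro sum.cong refl Bochner_Integration.integral_sum[symmetric] integrable_mult_right integrable_shifted) auto
    also have "\<dots> = (LINT x|M. (\<Sum>m=1..n. \<Sum>s\<in>S. \<beta> m i s * (indicator C x * g m (U s x))))"
      using g by (intro Bochner_Integration.integral_sum[symmetric] Bochner_Integration.integrable_sum
          integrable_mult_right integrable_shifted) auto
    also have "\<dots> = (LINT x|M. indicator C x * ?h x)"
      by (simp add: sum_distrib_left mult.left_commute)
    finally have 1: "(\<Sum>m=1..n. \<Sum>s\<in>S. \<beta> m i s * shifted_mass (g m) s C) = (LINT x|M. indicator C x * ?h x)" .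
    have 2: "prob (F i \<inter> C) = (LINT x|M. indicator C x * indicator (F i) x)"
    proof -
      have "prob (F i \<inter> C) = (LINT x|M. indicator (F i \<inter> C) x)" by simp
      also have "\<dots> = (LINT x|M. indicator C x * indicator (F i) x)"
        by (intro Bochner_Integration.integral_cong) (auto simp: indicator_def)
      finally show ?thesis .
    qed
    have int1: "integrable M (\<lambda>x. indicator C x * ?h x)"
      using integrable_mult_indicator[OF C int_h] by simp
    have int2: "integrable M (\<lambda>x. indicator C x * indicat_real (F i) x)"
      using integrable_mult_indicator[OF C int_F] by simp
    have "\<bar>(LINT x|M. indicator C x * ?h x) - (LINT x|M. indicator C x * indicator (F i) x)\<bar> =
        \<bar>LINT x|M. indicator C x * ?h x - indicator C x * indicator (F i) x\<bar>"
      using int1 int2 by simp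
    also have "\<dots> \<le> (LINT x|M. \<bar>indicator C x * ?h x - indicator C x * indicator (F i) x\<bar>)"
      by (rule integral_abs_bound)
    also have "\<dots> \<le> (LINT x|M. \<bar>indicator (F i) x - ?h x\<bar>)"
    proof (rule integral_mono)
      show "integrable M (\<lambda>x. \<bar>indicator C x * ?h x - indicator C x * indicat_real (F i) x\<bar>)"
        by (intro integrable_abs Bochner_Integration.integrable_diff int1 int2)
      show "integrable M (\<lambda>x. \<bar>indicat_real (F i) x - ?h x\<bar>)"
        by (intro integrable_abs Bochner_Integration.integrable_diff int_F int_h)
      show "\<bar>indicator C x * ?h x - indicator C x * indicat_real (F i) x\<bar> \<le> \<bar>indicat_real (F i) x - ?h x\<bar>" for x
        by (cases "x \<in> C") (simp_all add: abs_minus_commute)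
    qed
    also have "\<dots> < \<epsilon>" by (rule approx[OF i])
    finally show ?thesis by (simp only: 1 2)
  qed
  \<comment> \<open>Adding the approximations of the disjoint pieces approximates the indicator of
    their union.\<close>
  define \<gamma> where "\<gamma> m s = (\<Sum>i=1..r. \<beta> m i s)" for m s
  have \<gamma>: "0 \<le> \<gamma> m s" if "m \<in> {1..n}" for m s
    unfolding \<gamma>_def using \<beta>[OF that] by (intro sum_nonneg) auto
  define H where "H C = (\<Sum>m=1..n. \<Sum>s\<in>S. \<gamma> m s * shifted_mass (g m) s C)" for C
  have H_swap: "H C = (\<Sum>i=1..r. \<Sum>m=1..n. \<Sum>s\<in>S. \<beta> m i s * shifted_mass (g m) s C)" for C
  proof -
    have "H C = (\<Sum>m=1..n. \<Sum>s\<in>S. \<Sum>i=1..r. \<beta> m i s * shifted_mass (g m) s C)"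
      by (simp add: H_def \<gamma>_def sum_distrib_right)
    also have "\<dots> = (\<Sum>m=1..n. \<Sum>i=1..r. \<Sum>s\<in>S. \<beta> m i s * shifted_mass (g m) s C)"
      by (intro sum.cong refl sum.swap)
    also have "\<dots> = (\<Sum>i=1..r. \<Sum>m=1..n. \<Sum>s\<in>S. \<beta> m i s * shifted_mass (g m) s C)"
      by (rule sum.swap)
    finally show ?thesis .
  qed
  define F' where "F' = (\<Union>i\<in>{1..r}. F i)"
  have F'_sets: "F' \<in> sets M" unfolding F'_def using F by auto
  have H_close: "\<bar>H C - prob (F' \<inter> C)\<bar> \<le> \<delta>" if C: "C \<in> sets M" for C
  proof -
    have "prob (F' \<inter> C) = prob (\<Union>i\<in>{1..r}. F i \<inter> C)"
      by (rule arg_cong[where f = prob]) (auto simp: F'_def)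
    also have "\<dots> = (\<Sum>i=1..r. prob (F i \<inter> C))"
    proof (rule finite_measure_finite_Union)
      show "(\<lambda>i. F i \<inter> C) ` {1..r} \<subseteq> sets M" using F C by auto
      show "disjoint_family_on (\<lambda>i. F i \<inter> C) {1..r}"
        using disj unfolding disjoint_family_on_def by blast
    qed simp
    finally have "\<bar>H C - prob (F' \<inter> C)\<bar> =
        \<bar>\<Sum>i=1..r. (\<Sum>m=1..n. \<Sum>s\<in>S. \<beta> m i s * shifted_mass (g m) s C) - prob (F i \<inter> C)\<bar>"
      by (simp add: H_swap sum_subtractf)
    also have "\<dots> \<le> (\<Sum>i=1..r. \<bar>(\<Sum>m=1..n. \<Sum>s\<in>S. \<beta> m i s * shifted_mass (g m) s C) - prob (F i \<inter> C)\<bar>)"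
      by (rule sum_abs)
    also have "\<dots> \<le> (\<Sum>i=1..r. \<epsilon>)" using close C by (intro sum_mono) auto
    finally show ?thesis using r\<epsilon> by simp
  qed
  have term_le: "\<beta> m i s * shifted_mass (g m) s C \<le> prob (F i \<inter> C) + \<epsilon>"
    if m: "m \<in> {1..n}" and i: "i \<in> {1..r}" and s: "s \<in> S" and C: "C \<in> sets M" for m i s C
  proof -
    have nonneg: "0 \<le> \<beta> m' i s' * shifted_mass (g m') s' C" if "m' \<in> {1..n}" for m' s'
      using \<beta>[OF that i] g(2)[OF that] by (intro mult_nonneg_nonneg shifted_mass_nonneg)
    have "\<beta> m i s * shifted_mass (g m) s C \<le> (\<Sum>s\<in>S. \<beta> m i s * shifted_mass (g m) s C)"
      using nonneg[OF m] s S by (intro member_le_sum[of s S]) auto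
    also have "\<dots> \<le> (\<Sum>m=1..n. \<Sum>s\<in>S. \<beta> m i s * shifted_mass (g m) s C)"
      using nonneg m by (intro member_le_sum[of m "{1..n}"] sum_nonneg) auto
    also have "\<dots> \<le> prob (F i \<inter> C) + \<epsilon>" using close[OF i C] by linarith
    finally show ?thesis .
  qed
  text \<open>The pieces are disjoint, so at most one of them carries more than half of a given shifted
    density; all other pieces give this shift little weight.\<close>
  have \<tau>: "\<gamma> m s * (LINT x|M. g m x) \<le> 2 * \<theta>" if m: "m \<in> {1..n}" and s: "s \<in> S" for m s
  proof -
    let ?I = "LINT x|M. g m x"
    let ?G = "shifted_mass (g m) s"
    have I: "?G (space M) = ?I" by (rule shifted_mass_space[OF g(1)[OF m]])
    define B where "B = {i \<in> {1..r}. ?I < 2 * ?G (F i)}"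
    have "card B \<le> 1"
    proof (rule ccontr)
      assume "\<not> card B \<le> 1"
      then obtain i j where ij: "i \<in> B" "j \<in> B" "i \<noteq> j"
        by (metis One_nat_def card_le_Suc0_iff_eq finite_Collect_conjI finite_atLeastAtMost B_def Collect_mem_eq)
      then have r: "i \<in> {1..r}" "j \<in> {1..r}" by (auto simp: B_def)
      then have "F i \<inter> F j = {}" using disj ij by (auto simp: disjoint_family_on_def)
      then have "?G (F i \<union> F j) = ?G (F i) + ?G (F j)"
        using F(1) r by (intro shifted_mass_Un g m) auto
      moreover have "?G (F i \<union> F j) \<le> ?G (space M)"
        using F(1) r g[OF m] F(1)[THEN sets.sets_into_space] by (intro shifted_mass_mono Un_least) auto
      ultimately show False using ij by (auto simp: B_def I)
    qed
    have "\<beta> m i s * ?I \<le> 2 * \<epsilon> + (if i \<in> B then \<theta> + \<epsilon> else 0)" if i: "i \<in> {1..r}" for i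
    proof (cases "i \<in> B")
      case True
      have "\<beta> m i s * ?G (space M) \<le> prob (F i \<inter> space M) + \<epsilon>"
        by (rule term_le[OF m i s]) simp
      also have "F i \<inter> space M = F i" using sets.sets_into_space[OF F(1)[OF i]] by blast
      finally show ?thesis using F(3)[OF i] True \<epsilon> by (simp add: I)
    next
      case False
      \<comment> \<open>For a piece outside \<open>B\<close> at least half of the mass of the term
        lies off \<open>F i\<close>, where the approximation of its indicator has mass at most
        \<open>\<epsilon>\<close>.\<close>
      have "F i \<union> (space M - F i) = space M" using sets.sets_into_space[OF F(1)[OF i]] by blast
      then have "?I = ?G (F i) + ?G (space M - F i)"
        using shifted_mass_Un[OF g(1)[OF m], of "F i" "space M - F i" s] F(1)[OF i] by (simp add: I)
      then have "?I \<le> 2 * ?G (space M - F i)" using False i by (simp add: B_def)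
      then have "\<beta> m i s * ?I \<le> \<beta> m i s * (2 * ?G (space M - F i))"
        using \<beta>[OF m i] by (intro mult_left_mono)
      also have "\<dots> \<le> 2 * \<epsilon>"
        using term_le[OF m i s, of "space M - F i"] F(1)[OF i] by (simp add: Diff_disjoint)
      finally show ?thesis using False by simp
    qed
    then have "(\<Sum>i=1..r. \<beta> m i s * ?I) \<le> (\<Sum>i=1..r. 2 * \<epsilon> + (if i \<in> B then \<theta> + \<epsilon> else 0))"
      by (rule sum_mono)
    also have "\<dots> = 2 * (real r * \<epsilon>) + real (card B) * (\<theta> + \<epsilon>)"
    proof -
      have "{1..r} \<inter> B = B" by (auto simp: B_def)
      then show ?thesis by (simp add: sum.distrib sum.If_cases)
    qed
    also have "\<dots> \<le> 2 * \<delta> + 1 * (\<theta> + \<epsilon>)"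
      using r\<epsilon> \<open>card B \<le> 1\<close> \<theta> \<epsilon> by (intro add_mono mult_right_mono) auto
    also have "\<dots> \<le> 2 * \<theta>"
    proof -
      have "\<delta> \<le> \<theta> / 3" unfolding \<delta>_def by (rule min.cobounded1)
      then have "3 * \<delta> \<le> \<theta>" by simp
      moreover have "2 * \<delta> + 1 * (\<theta> + \<epsilon>) \<le> 2 * \<delta> + 1 * (\<theta> + \<delta>)"
        using r\<epsilon>(2) by (intro add_left_mono mult_left_mono) auto
      ultimately show ?thesis by (simp add: algebra_simps)
    qed
    finally show ?thesis by (simp add: \<gamma>_def sum_distrib_right)
  qed
  have "H (space M) \<le> real n * (real J * (2 * \<theta>)) + \<delta> / \<eta> + real n * (\<kappa> ^ J / (1 - \<kappa>)) + \<delta>"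
    unfolding H_def
  proof (rule mass_bound[OF S g \<gamma> \<tau> _ \<eta> \<kappa> freq])
    fix C assume C: "C \<in> sets M"
    have "prob (F' \<inter> C) \<le> prob C" using C by (intro finite_measure_mono) auto
    then show "(\<Sum>m=1..n. \<Sum>s\<in>S. \<gamma> m s * shifted_mass (g m) s C) \<le> prob C + \<delta>"
      using H_close[OF C] unfolding H_def by linarith
  next
    have "F' \<inter> (space M - A) = {}" using F(2) unfolding F'_def by blast
    then show "(\<Sum>m=1..n. \<Sum>s\<in>S. \<gamma> m s * shifted_mass (g m) s (space M - A)) \<le> \<delta>"
      using H_close[of "space M - A"] unfolding H_def by simp
  qed (use \<theta> in auto)
  moreover have "a / 2 - \<delta> \<le> H (space M)"
  proof -
    have "a / 2 \<le> prob F'" using big by (simp only: F'_def)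
    moreover have "F' \<inter> space M = F'" using sets.sets_into_space[OF F'_sets] by blast
    ultimately show ?thesis using H_close[of "space M"] by simp
  qed
  moreover have "real n * (real J * (2 * \<theta>)) \<le> a / 16"
  proof -
    have "real n * real J \<le> (real n + 1) * (real J + 1)" by (intro mult_mono) auto
    then have "(real n * real J) * a \<le> ((real n + 1) * (real J + 1)) * a"
      using a by (intro mult_right_mono) auto
    moreover have "0 < (real n + 1) * (real J + 1)" by simp
    ultimately show ?thesis unfolding \<theta>_def by (simp add: field_simps)
  qed
  moreover have "real n * (\<kappa> ^ J / (1 - \<kappa>)) \<le> a / 16"
  proof -
    have "\<kappa> ^ J / (1 - \<kappa>) \<le> a / (16 * (real n + 1))"
      using J \<kappa> by (simp add: field_simps)
    then have "real n * (\<kappa> ^ J / (1 - \<kappa>)) \<le> real n * (a / (16 * (real n + 1)))"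
      by (intro mult_left_mono) auto
    also have "\<dots> \<le> a / 16" using a by (simp add: field_simps)
    finally show ?thesis .
  qed
  moreover have "\<delta> * (2 + 1 / \<eta>) \<le> a / 16"
  proof -
    have "0 < 2 + 1 / \<eta>" using \<eta> by (simp add: add_pos_pos)
    moreover have "\<delta> \<le> (a / 16) / (2 + 1 / \<eta>)"
      unfolding \<delta>_def divide_divide_eq_left by (rule min.cobounded2)
    ultimately show ?thesis by (simp only: pos_le_divide_eq)
  qed
  then have "2 * \<delta> + \<delta> / \<eta> \<le> a / 16" by (simp add: algebra_simps)
  ultimately show False using a by linarith
qed

end


section \<open>Zero entropy\<close>

theorem corollary3p3:
  fixes M :: "'a measure" and T :: "'a \<Rightarrow> 'a" and n :: nat
  assumes "1 \<le> n"
    and "standard_prob_space M"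
    and "mp_automorphism M T"
    and "ergodic M T"
    and "AT n M T"
  shows "KS_entropy M T = 0"
proof -
  interpret prob_space M
    using assms(2) by (simp add: standard_prob_space_def)
  have "entropy_wrt M T P = 0" if "finite_partition M P" for P
  proof -
    interpret partition_process M T P
      by unfold_locales (use assms(3) that in auto)
    have "(\<lambda>n. ent (itinerary n) / real n) \<longlonglongrightarrow> 0"
    proof (rule ccontr)
      assume "\<not> ?thesis"
      from exists_unpredictable_set[OF this] obtain A q where
        "A \<in> sets M" "0 < prob A" "0 \<le> q" "q < 1"
        "\<And>S. finite S \<Longrightarrow> prob {x \<in> space M. \<forall>s\<in>S. (T ^^ s) x \<in> A} \<le> q ^ card S"
        by blast
      then interpret unpredictable_set M T A q
        by unfold_locales
      show False using not_AT assms(5) by blast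
    qed
    \<comment> \<open>As \<open>entropy_wrt\<close> is a \<open>lim\<close>, convergence to 0
      determines its value.\<close>
    then show ?thesis
      unfolding entropy_wrt_def partition_entropy_dyn_join by (rule limI)
  qed
  \<comment> \<open>The trivial partition makes the supremum range over a nonempty set; over the
    empty set it would be minus infinity.\<close>
  moreover have "finite_partition M {space M}"
    using not_empty by (auto simp: finite_partition_def partition_on_def)
  ultimately have "(\<lambda>P. ereal (entropy_wrt M T P)) ` {P. finite_partition M P} = {0}"
    by force
  then show ?thesis by (simp add: KS_entropy_def)
qed

end
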